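(* Let $K$ be a non-classical virtual knot diagram with $\Phi\Delta(K)\neq 0$. If $K'$ is a knot diagram obtained from $K$ by switching odd crossings of $K$ from positive to negative or vice versa, then $K'$ is non-trivial, i.e. $K'$ is not equivalent to the unknot as a virtual knot.
   Context: A virtual knot diagram is an immersion of an oriented circle $S^1$ into the plane whose double points are decorated either as classical crossings (over/under information) or as virtual crossings (circled, no over/under information). Two diagrams are equivalent if related by Reidemeister moves I, II, III on classical crossings, virtual Reidemeister moves I, II, III (the same moves with all crossings virtual), and virtual Reidemeister move IV (an arc with two consecutive virtual crossings is moved past a classical crossing). A diagram is classical if it is equivalent to a diagram without virtual crossings, and non-classical otherwise. Parity: label the classical crossings, choose a base point, traverse the knot and record the label of each classical crossing when encountered; each label occurs twice in the resulting cyclic word. A classical crossing is even (respectively odd) if the number of letters between its two occurrences is even (respectively odd). Switching a crossing means exchanging its over and under strands (so its sign changes). Virtual semi-arcs are the edges of the diagram that begin and end at a (classical or virtual) crossing, with no crossing in the interior; a diagram with $n\ge1$ crossings in total has $2n$ virtual semi-arcs, labelled $a_1,\dots,a_{2n}$. Each crossing gives two relations in the free group on $a_1,\dots,a_{2n},s,q,\theta$. Draw the crossing with both strands oriented upward; let $x,y$ be the labels of the incoming bottom-left and bottom-right semi-arcs, and $z,w$ the labels of the outgoing top-left and top-right semi-arcs. A classical crossing is positive if the over strand runs from $x$ to $w$, and negative if the over strand runs from $y$ to $z$. The relations are: - even positive crossing: $z=xysx^{-1}s^{-1}$, $w=sxs^{-1}$; - even negative crossing: $z=s^{-1}ys$,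 $w=s^{-1}y^{-1}sxy$; - odd crossing of either sign: $z=\theta^{-1}y\theta$, $w=\theta x\theta^{-1}$; - virtual crossing: $z=q^{-1}yq$, $w=qxq^{-1}$. A relation $u=W$ is written as the relator $Wu^{-1}$; let $r_1,\dots,r_{2n}$ be the relators so obtained, and let $r_{2n+1}=[s,q]$, $r_{2n+2}=[s,\theta]$, $r_{2n+3}=[\theta,q]$, where $[a,b]=aba^{-1}b^{-1}$. Let $M$ be the $(2n+3)\times(2n+3)$ matrix of Fox free derivatives of $r_1,\dots,r_{2n+3}$ with respect to $a_1,\dots,a_{2n},s,q,\theta$, evaluated in $\mathbb{Z}[s^{\pm1},t^{\pm1},q^{\pm1},\theta^{\pm1}]$ by sending every $a_i$ to $t$ and $s,q,\theta$ to themselves. The parity virtual Alexander polynomial $\Phi\Delta(K)$ is the greatest common divisor of the $(2n+2)\times(2n+2)$ minors of $M$, defined up to units of the ring; up to units it equals the determinant of the $2n\times2n$ matrix $(\partial r_i/\partial a_j)_{1\le i,j\le 2n}$ and is an invariant of the virtual knot. For a diagram without crossings, $\Phi\Delta=0$. *)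

theory Defs
  imports
    "HOL-Library.Poly_Mapping"
    "HOL-Library.Product_Plus"
    "Jordan_Normal_Form.Determinant"
begin

section \<open>Virtual knot diagrams\<close>

text \<open>
  A diagram is recorded by its signed planar Gauss code. Traversing the oriented circle from a base
  point, every crossing (classical or virtual) is passed twice. Draw the crossing with both strands
  oriented upward: one passage enters at the bottom left and leaves at the top right
  (\<open>From_Left\<close>), the other one enters at the bottom right and leaves at the top left
  (\<open>From_Right\<close>). The code is the cyclic list of all passages, cut open at the base point.
  It determines the immersed curve up to orientation-preserving homeomorphism of the sphere,
  the empty code being the embedded circle.
\<close>

datatype entry = From_Left | From_Right

fun opp :: "entry \<Rightarrow> entry" where
  "opp From_Left = From_Right"
| "opp From_Right = From_Left"

datatype crossing_kind = Positive | Negative | Virtual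

type_synonym passage = "nat \<times> entry"

datatype diagram = Diagram (code: "passage list") (kind: "nat \<Rightarrow> crossing_kind")

definition crossings :: "diagram \<Rightarrow> nat set" where
  "crossings D = fst ` set (code D)"

text \<open>
  A crossing is positive if its over strand runs from bottom left to top right, and negative if its
  over strand runs from bottom right to top left.
\<close>

definition is_over :: "(nat \<Rightarrow> crossing_kind) \<Rightarrow> passage \<Rightarrow> bool" where
  "is_over \<kappa> p \<longleftrightarrow>
     \<kappa> (fst p) = Positive \<and> snd p = From_Left \<or> \<kappa> (fst p) = Negative \<and> snd p = From_Right"

text \<open>
  The \<open>n\<close> crossings cut the curve into \<open>2 n\<close> semi-arcs. Semi-arc \<open>i\<close> leads from the passage at
  position \<open>i\<close> of the code to the cyclically next passage.
\<close>

definition position :: "passage list \<Rightarrow> passage \<Rightarrow> nat" where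
  "position w p = length (takeWhile (\<lambda>r. r \<noteq> p) w)"

definition out_arc :: "passage list \<Rightarrow> passage \<Rightarrow> nat" where
  "out_arc w p = position w p"

definition in_arc :: "passage list \<Rightarrow> passage \<Rightarrow> nat" where
  "in_arc w p = (position w p + length w - 1) mod length w"

text \<open>
  A dart is a semi-arc with a direction of travel, \<open>True\<close> being the orientation of the knot.
  Walking along a dart with a face on the left-hand side, one turns left at the next crossing. In
  counterclockwise order the ends at a crossing are: bottom left, bottom right, top right, top left.
\<close>

fun face_step :: "passage list \<Rightarrow> nat \<times> bool \<Rightarrow> nat \<times> bool" where
  "face_step w (i, True) = (case w ! ((i + 1) mod length w) of
       (c, From_Left) \<Rightarrow> (out_arc w (c, From_Right), True)
     | (c, From_Right) \<Rightarrow> (in_arc w (c, From_Left), False))"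
| "face_step w (i, False) = (case w ! i of
       (c, From_Left) \<Rightarrow> (in_arc w (c, From_Right), False)
     | (c, From_Right) \<Rightarrow> (out_arc w (c, From_Left), True))"

definition faces :: "passage list \<Rightarrow> (nat \<times> bool) set set" where
  "faces w = (\<lambda>d. {(face_step w ^^ k) d | k. True}) ` ({..<length w} \<times> UNIV)"

definition well_formed :: "passage list \<Rightarrow> bool" where
  "well_formed w \<longleftrightarrow> distinct w \<and> (\<forall>c e. (c, e) \<in> set w \<longrightarrow> (c, opp e) \<in> set w)"

text \<open>
  Euler's formula for the underlying (connected, 4-valent) graph with \<open>n\<close> vertices and \<open>2 n\<close>
  edges: the code is realised by a curve in the sphere iff there are \<open>n + 2\<close> faces.
\<close>

definition planar :: "passage list \<Rightarrow> bool" where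
  "planar w \<longleftrightarrow> w = [] \<or> card (faces w) = length w div 2 + 2"

definition knot_diagram :: "diagram \<Rightarrow> bool" where
  "knot_diagram D \<longleftrightarrow> well_formed (code D) \<and> planar (code D)"

definition unknot :: diagram where
  "unknot = Diagram [] (\<lambda>_. Virtual)"


section \<open>Equivalence of virtual knots\<close>

text \<open>
  Two strands bound a bigon iff they meet consecutively at two crossings and the first strand
  crosses the second one once from each side; the second strand may run parallel or antiparallel to
  the first one. For a classical move one of the strands is over at both crossings.
\<close>

definition r2_kinds :: "(nat \<Rightarrow> crossing_kind) \<Rightarrow> passage \<Rightarrow> passage \<Rightarrow> bool" where
  "r2_kinds \<kappa> p p' \<longleftrightarrow>
     (\<kappa> (fst p) = Virtual \<and> \<kappa> (fst p') = Virtual) \<or>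
     (\<kappa> (fst p) \<noteq> Virtual \<and> \<kappa> (fst p') \<noteq> Virtual \<and> is_over \<kappa> p = is_over \<kappa> p')"

text \<open>
  The three disjuncts are: the virtual move III, the move IV (the strand avoiding the only
  classical crossing has two consecutive virtual crossings), and the classical move III, where some
  strand lies over the two others. The list contains, for each of the three strands, its two
  successive passages.
\<close>

definition r3_kinds :: "(nat \<Rightarrow> crossing_kind) \<Rightarrow> (passage \<times> passage) list \<Rightarrow> bool" where
  "r3_kinds \<kappa> ps \<longleftrightarrow> (let C = (\<Union>(p, p') \<in> set ps. {fst p, fst p'}) in
     (\<forall>c\<in>C. \<kappa> c = Virtual) \<or>
     card {c \<in> C. \<kappa> c \<noteq> Virtual} = 1 \<or>
     (\<forall>c\<in>C. \<kappa> c \<noteq> Virtual) \<and> (\<exists>(p, p') \<in> set ps. is_over \<kappa> p \<and> is_over \<kappa> p'))"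

text \<open>
  \<open>relabel\<close> makes base point and crossing labels irrelevant. A move of type III flips a triangular
  face: each of the three strands traverses its two crossings in the opposite order, everything
  else being unchanged.
\<close>

inductive move :: "diagram \<Rightarrow> diagram \<Rightarrow> bool" where
  relabel: "inj_on f (fst ` set w) \<Longrightarrow> (\<And>c. c \<in> fst ` set w \<Longrightarrow> \<kappa>' (f c) = \<kappa> c) \<Longrightarrow>
     move (Diagram w \<kappa>) (Diagram (map (\<lambda>(c, e). (f c, e)) (rotate m w)) \<kappa>')"
| R1: "move (Diagram (u @ [(c, e), (c, opp e)] @ v) \<kappa>) (Diagram (u @ v) \<kappa>)"
| R2_parallel: "r2_kinds \<kappa> (c, e) (d, opp e) \<Longrightarrow>
     move (Diagram (u @ [(c, e), (d, opp e)] @ v @ [(c, opp e), (d, e)] @ w) \<kappa>)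
          (Diagram (u @ v @ w) \<kappa>)"
| R2_antiparallel: "r2_kinds \<kappa> (c, e) (d, opp e) \<Longrightarrow>
     move (Diagram (u @ [(c, e), (d, opp e)] @ v @ [(d, e), (c, opp e)] @ w) \<kappa>)
          (Diagram (u @ v @ w) \<kappa>)"
| R3: "w = u0 @ [p1, p1'] @ u1 @ [p2, p2'] @ u2 @ [p3, p3'] @ u3 \<Longrightarrow>
     {(out_arc w p1, b1), (out_arc w p2, b2), (out_arc w p3, b3)} \<in> faces w \<Longrightarrow>
     r3_kinds \<kappa> [(p1, p1'), (p2, p2'), (p3, p3')] \<Longrightarrow>
     move (Diagram w \<kappa>)
          (Diagram (u0 @ [p1', p1] @ u1 @ [p2', p2] @ u2 @ [p3', p3] @ u3) \<kappa>)"

definition equivalent :: "diagram \<Rightarrow> diagram \<Rightarrow> bool" where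
  "equivalent = equivclp (\<lambda>D D'. knot_diagram D \<and> knot_diagram D' \<and> move D D')"

definition is_classical :: "diagram \<Rightarrow> bool" where
  "is_classical D \<longleftrightarrow>
     (\<exists>D'. knot_diagram D' \<and> (\<forall>c \<in> crossings D'. kind D' c \<noteq> Virtual) \<and> equivalent D D')"


section \<open>Parity and crossing switches\<close>

definition classical_word :: "diagram \<Rightarrow> nat list" where
  "classical_word D = filter (\<lambda>c. kind D c \<noteq> Virtual) (map fst (code D))"

definition letters_between :: "nat \<Rightarrow> nat list \<Rightarrow> nat list" where
  "letters_between c l = takeWhile (\<lambda>d. d \<noteq> c) (tl (dropWhile (\<lambda>d. d \<noteq> c) l))"

definition odd_crossings :: "diagram \<Rightarrow> nat set" where
  "odd_crossings D = {c \<in> crossings D. kind D c \<noteq> Virtual \<and>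
     odd (length (letters_between c (classical_word D)))}"

fun switch_kind :: "crossing_kind \<Rightarrow> crossing_kind" where
  "switch_kind Positive = Negative"
| "switch_kind Negative = Positive"
| "switch_kind Virtual = Virtual"

definition switch_crossings :: "nat set \<Rightarrow> diagram \<Rightarrow> diagram" where
  "switch_crossings S D =
     Diagram (code D) (\<lambda>c. if c \<in> S then switch_kind (kind D c) else kind D c)"


section \<open>Fox calculus\<close>

text \<open>
  Elements of the free group are represented by words in the generators (\<open>True\<close>) and their inverses
  (\<open>False\<close>), elements of its integral group ring by formal sums of such words with coefficients.
\<close>

type_synonym 'g fword = "('g \<times> bool) list"
type_synonym 'g fsum = "(int \<times> 'g fword) list"

definition gen :: "'g \<Rightarrow> 'g fword" where
  "gen g = [(g, True)]"

definition inv_word :: "'g fword \<Rightarrow> 'g fword" where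
  "inv_word u = map (\<lambda>(g, b). (g, \<not> b)) (rev u)"

definition commutator_word :: "'g fword \<Rightarrow> 'g fword \<Rightarrow> 'g fword" where
  "commutator_word a b = a @ b @ inv_word a @ inv_word b"

text \<open>
  The derivation with \<open>\<partial>(u v) = \<partial>u + u \<partial>v\<close>, \<open>\<partial>g/\<partial>g = 1\<close>, hence \<open>\<partial>g\<inverse>/\<partial>g = - g\<inverse>\<close>.
\<close>

fun fox :: "'g \<Rightarrow> 'g fword \<Rightarrow> 'g fsum" where
  "fox x [] = []"
| "fox x ((g, b) # u) =
     (if g = x then [if b then (1, []) else (- 1, [(g, False)])] else []) @
     map (\<lambda>(k, v). (k, (g, b) # v)) (fox x u)"


section \<open>The parity virtual Alexander polynomial\<close>

text \<open>
  Laurent polynomials over the integers in \<open>s\<close>, \<open>t\<close>, \<open>q\<close>, \<open>\<theta>\<close>, as finitely supported functions on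
  the exponent vectors (in this order), i.e. the group ring of the free abelian group of rank 4.
\<close>

type_synonym laurent = "(int \<times> int \<times> int \<times> int) \<Rightarrow>\<^sub>0 int"

datatype generator = Arc nat | Gen_s | Gen_q | Gen_theta

fun exponent :: "generator \<Rightarrow> int \<times> int \<times> int \<times> int" where
  "exponent (Arc i) = (0, 1, 0, 0)"
| "exponent Gen_s = (1, 0, 0, 0)"
| "exponent Gen_q = (0, 0, 1, 0)"
| "exponent Gen_theta = (0, 0, 0, 1)"

definition eval_word :: "generator fword \<Rightarrow> laurent" where
  "eval_word u =
     prod_list (map (\<lambda>(g, b). Poly_Mapping.single (if b then exponent g else - exponent g) 1) u)"

definition eval_fsum :: "generator fsum \<Rightarrow> laurent" where
  "eval_fsum a = sum_list (map (\<lambda>(k, u). of_int k * eval_word u) a)"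

text \<open>The relators of a crossing; the strands run from \<open>x\<close> to \<open>w\<close> and from \<open>y\<close> to \<open>z\<close>.\<close>

definition crossing_relators :: "diagram \<Rightarrow> nat \<Rightarrow> generator fword list" where
  "crossing_relators D c =
    (let x = gen (Arc (in_arc (code D) (c, From_Left)));
         y = gen (Arc (in_arc (code D) (c, From_Right)));
         z = gen (Arc (out_arc (code D) (c, From_Right)));
         w = gen (Arc (out_arc (code D) (c, From_Left)));
         s = gen Gen_s; q = gen Gen_q; \<theta> = gen Gen_theta;
         s' = inv_word s; q' = inv_word q; \<theta>' = inv_word \<theta>;
         (Z, W) =
           (if kind D c = Virtual then (q' @ y @ q, q @ x @ q')
            else if c \<in> odd_crossings D then (\<theta>' @ y @ \<theta>, \<theta> @ x @ \<theta>')
            else if kind D c = Positive then (x @ y @ s @ inv_word x @ s', s @ x @ s')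
            else (s' @ y @ s, s' @ inv_word y @ s @ x @ y))
     in [Z @ inv_word z, W @ inv_word w])"

definition relators :: "diagram \<Rightarrow> generator fword list" where
  "relators D = concat (map (crossing_relators D) (remdups (map fst (code D)))) @
     [commutator_word (gen Gen_s) (gen Gen_q),
      commutator_word (gen Gen_s) (gen Gen_theta),
      commutator_word (gen Gen_theta) (gen Gen_q)]"

definition generators :: "diagram \<Rightarrow> generator list" where
  "generators D = map Arc [0..<length (code D)] @ [Gen_s, Gen_q, Gen_theta]"

definition alexander_matrix :: "diagram \<Rightarrow> laurent mat" where
  "alexander_matrix D = mat (length (code D) + 3) (length (code D) + 3)
     (\<lambda>(i, j). eval_fsum (fox (generators D ! j) (relators D ! i)))"

text \<open>The minors obtained by deleting one row and one column.\<close>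

definition first_minors :: "'a :: comm_ring_1 mat \<Rightarrow> 'a set" where
  "first_minors A = {det (mat_delete A i j) | i j. i < dim_row A \<and> j < dim_col A}"

definition is_gcd :: "'a :: comm_semiring_1 set \<Rightarrow> 'a \<Rightarrow> bool" where
  "is_gcd X d \<longleftrightarrow> (\<forall>x\<in>X. d dvd x) \<and> (\<forall>d'. (\<forall>x\<in>X. d' dvd x) \<longrightarrow> d' dvd d)"

text \<open>
  The polynomial is only defined up to units; \<open>SOME\<close> picks a representative. Greatest common
  divisors exist because Laurent polynomials over the integers form a factorial ring.
\<close>

definition PhiDelta :: "diagram \<Rightarrow> laurent" where
  "PhiDelta D =
     (if code D = [] then 0 else (SOME d. is_gcd (first_minors (alexander_matrix D)) d))"

end

theory Submission
  imports Defs "HOL-Library.Product_Lexorder"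
begin

text \<open>
  Switching odd crossings does not change the parity of any crossing, and the relators of an odd
  crossing do not mention its sign. So \<open>K\<close> and \<open>K'\<close> have literally the same Alexander matrix, and
  it remains to see that a diagram that is equivalent to the unknot has vanishing polynomial.

  For this only the vanishing of the polynomial has to be invariant under moves, and vanishing is
  a statement about kernels. The matrix represents the linear map that sends the values \<open>\<delta> g\<close>
  on the generators to the values on the relators of the derivation extending \<open>\<delta>\<close>
  (\<open>derivation_eq_sum_fox\<close>). One kernel vector is always there: the fundamental formula of Fox
  provides \<open>g - 1\<close> (\<open>derivation_fundamental\<close>). All first minors vanish as soon as there is a second,
  independent one (\<open>first_minors_eq_zero\<close>). A kernel vector that vanishes on \<open>s\<close>, \<open>q\<close> and \<open>\<theta>\<close> is a
  colouring of the semi-arcs by Laurent polynomials that satisfies two linear equations at every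
  crossing; if it is nonzero, it is independent of \<open>g - 1\<close>, whose entry at \<open>s\<close> is nonzero. Hence
  \<open>\<Phi>\<Delta>\<close> vanishes if the diagram has a nonzero colouring (\<open>PhiDelta_colourable\<close>). The unknot has
  one, a constant on its single closed arc.

  So the core is that the existence of a nonzero colouring is invariant under every move
  (\<open>colourable_move\<close>): colours outside the affected disc are kept, and those inside can be
  replaced in exactly one way. Three points deserve attention.

  \<^item> Parity. The two crossings of a classical bigon have equal parity, and among three classical
    crossings of a triangle an even number is odd. Both facts follow from one reformulation:
    a classical crossing is odd iff equally many classical passages, modulo 2, precede its two
    passages (\<open>odd_crossings_iff\<close>).

  \<^item> The third move. An odd or virtual crossing just rescales both strands by inverse units. By
    parity and by the kinds of crossings that the move admits, in a triangle either two corners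
    rescale by the same unit, and then the relation at the third corner is preserved because it is
    homogeneous, or all three crossings are even and classical and some strand runs over the two
    others, which is the classical computation with the Alexander module (\<open>triangle_flip\<close>).

  \<^item> All orientations of the third move are treated together by following the boundary of the triangular
    face instead of the orientation of the knot. From this point of view the corners form a
    3-cycle (\<open>face_triangle\<close>) and the algebra is cyclically symmetric.
\<close>

section \<open>The linear relations at a crossing and at a triangle\<close>

text \<open>What the relators of a crossing depend on.\<close>

datatype crossing_type = Virtual_Type | Odd_Type | Even_Positive | Even_Negative

text \<open>
  The type of an even crossing whose over strand is the one entering from the left, respectively
  from the right.
\<close>

definition over_type :: "bool \<Rightarrow> crossing_type" where
  "over_type from_left = (if from_left then Even_Positive else Even_Negative)"

text \<open>
  The invariance under moves rests on the invertibility of the four variables. The primed letters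
  are the inverses.
\<close>

locale colouring_units =
  fixes s s' t t' q q' \<theta> \<theta>' :: "'a :: idom"
  assumes s: "s * s' = 1" and t: "t * t' = 1" and q: "q * q' = 1" and \<theta>: "\<theta> * \<theta>' = 1"
begin

lemma unit_cancel [simp]:
  "s * s' = 1" "s' * s = 1" "t * t' = 1" "t' * t = 1"
  "q * q' = 1" "q' * q = 1" "\<theta> * \<theta>' = 1" "\<theta>' * \<theta> = 1"
  "s * (s' * x) = x" "s' * (s * x) = x" "t * (t' * x) = x" "t' * (t * x) = x"
  "q * (q' * x) = x" "q' * (q * x) = x" "\<theta> * (\<theta>' * x) = x" "\<theta>' * (\<theta> * x) = x"
  using s t q \<theta> by (simp_all add: mult.commute mult.assoc [symmetric])

lemma unit_nonzero [simp]:
  "s \<noteq> 0" "s' \<noteq> 0" "t \<noteq> 0" "t' \<noteq> 0" "q \<noteq> 0" "q' \<noteq> 0" "\<theta> \<noteq> 0" "\<theta>' \<noteq> 0"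
  using s t q \<theta> by (metis mult_zero_left mult_zero_right zero_neq_one)+

text \<open>
  The relations \<open>z = Z\<close> and \<open>w = W\<close> of a crossing after applying a derivation that vanishes on
  \<open>s\<close>, \<open>q\<close>, \<open>\<theta>\<close>; here \<open>x\<close>, \<open>y\<close>, \<open>z\<close>, \<open>w\<close> are the colours of the bottom left, bottom right, top left
  and top right ends.
\<close>

fun crossing_rel :: "crossing_type \<Rightarrow> 'a \<Rightarrow> 'a \<Rightarrow> 'a \<Rightarrow> 'a \<Rightarrow> bool" where
  "crossing_rel Virtual_Type x y z w \<longleftrightarrow> z = q' * y \<and> w = q * x"
| "crossing_rel Odd_Type x y z w \<longleftrightarrow> z = \<theta>' * y \<and> w = \<theta> * x"
| "crossing_rel Even_Positive x y z w \<longleftrightarrow> z = (1 - t * s) * x + t * y \<and> w = s * x"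
| "crossing_rel Even_Negative x y z w \<longleftrightarrow> z = s' * y \<and> w = t' * x + (1 - s' * t') * y"

text \<open>
  The relation at a corner of a face that lies to the left of a walk along its boundary. The walk
  arrives along a first strand and turns left into a second one; \<open>b\<close> and \<open>b'\<close> tell whether it
  follows the orientations of these strands. In the direction of the walk the first strand has the
  colours \<open>m\<close> before and \<open>e\<close> after the crossing, the second one \<open>i\<close> before and \<open>m'\<close> after it, so
  that \<open>m\<close> and \<open>m'\<close> are the colours of the two sides of the face. Turning left pins down which end
  of the crossing is which.
\<close>

definition corner_rel :: "crossing_type \<Rightarrow> bool \<Rightarrow> bool \<Rightarrow> 'a \<Rightarrow> 'a \<Rightarrow> 'a \<Rightarrow> 'a \<Rightarrow> bool" where
  "corner_rel k b b' m e i m' \<longleftrightarrow>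
    (if b then if b' then crossing_rel k m i m' e else crossing_rel k m' m e i
     else if b' then crossing_rel k i e m m' else crossing_rel k e m' i m)"

text \<open>
  The colours of the two sides of the face determine the two opposite ends: the relation at a
  corner is the graph of the following pair of linear functions.
\<close>

fun corner_out :: "crossing_type \<Rightarrow> bool \<Rightarrow> bool \<Rightarrow> 'a \<Rightarrow> 'a \<Rightarrow> 'a" where
  "corner_out Virtual_Type b b' m m' = (if b' then q else q') * m"
| "corner_out Odd_Type b b' m m' = (if b' then \<theta> else \<theta>') * m"
| "corner_out Even_Positive b b' m m' = 
     (if b then if b' then s * m else (1 - t * s) * m' + t * m
      else if b' then t' * m + (1 - s' * t') * m' else s' * m)"
| "corner_out Even_Negative b b' m m' = 
     (if b then if b' then t' * m + (s - t') * m' else s' * m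
      else if b' then s * m else t * m + (s' - t) * m')"

fun corner_in :: "crossing_type \<Rightarrow> bool \<Rightarrow> bool \<Rightarrow> 'a \<Rightarrow> 'a \<Rightarrow> 'a" where
  "corner_in Virtual_Type b b' m m' = (if b then q else q') * m'"
| "corner_in Odd_Type b b' m m' = (if b then \<theta> else \<theta>') * m'"
| "corner_in Even_Positive b b' m m' = 
     (if b then if b' then t' * m' + (s - t') * m else s * m'
      else if b' then s' * m' else t * m' + (s' - t) * m)"
| "corner_in Even_Negative b b' m m' = 
     (if b then if b' then s * m' else t' * m' + (1 - s' * t') * m
      else if b' then t * m' + (1 - t * s) * m else s' * m')"

lemma corner_rel_iff:
  "corner_rel k b b' m e i m' \<longleftrightarrow> e = corner_out k b b' m m' \<and> i = corner_in k b b' m m'"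
proof -
  have solve: "x = c + u * y \<longleftrightarrow> y = v * (x - c)" if "u * v = 1" for u v x y c :: 'a
  proof -
    have "x = c + u * y \<longleftrightarrow> x - c = u * y"
      by (auto simp: algebra_simps)
    also have "x - c = u * (v * (x - c))"
      using that by (simp add: mult.assoc [symmetric])
    also have "\<dots> = u * y \<longleftrightarrow> y = v * (x - c)"
      using that by auto
    finally show ?thesis .
  qed
  note scaled = solve [where c = 0, simplified]
  have solve': "x = u * y + c \<longleftrightarrow> y = v * (x - c)" if "u * v = 1" for u v x y c :: 'a
    using solve [OF that] by (simp add: add.commute)
  \<comment> \<open>Instances with fixed variables: as general rewrite rules these equations would loop.\<close>
  have sols: "m = s * e \<longleftrightarrow> e = s' * m" "m' = s * i \<longleftrightarrow> i = s' * m'"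
     "m' = s' * i \<longleftrightarrow> i = s * m'" "m = s' * e \<longleftrightarrow> e = s * m"
     "m = q * e \<longleftrightarrow> e = q' * m" "m' = q * i \<longleftrightarrow> i = q' * m'"
     "m' = q' * i \<longleftrightarrow> i = q * m'" "m = q' * e \<longleftrightarrow> e = q * m"
     "m = \<theta> * e \<longleftrightarrow> e = \<theta>' * m" "m' = \<theta> * i \<longleftrightarrow> i = \<theta>' * m'"
     "m' = \<theta>' * i \<longleftrightarrow> i = \<theta> * m'" "m = \<theta>' * e \<longleftrightarrow> e = \<theta> * m"
     "m' = (1 - t * s) * m + t * i \<longleftrightarrow> i = t' * (m' - (1 - t * s) * m)"
     "m = (1 - t * s) * i + t * e \<longleftrightarrow> e = t' * (m - (1 - t * s) * i)"
     "m = t' * e + (1 - s' * t') * m' \<longleftrightarrow> e = t * (m - (1 - s' * t') * m')"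
     "m' = t' * i + (1 - s' * t') * e \<longleftrightarrow> i = t * (m' - (1 - s' * t') * e)"
    by (rule scaled solve solve'; simp)+
  show ?thesis
    unfolding corner_rel_def
    by (cases k; cases b; cases b'; simp add: sols)
       (auto simp: algebra_simps)
qed

lemma corner_rel_zero: "corner_rel k b b' m 0 0 m' \<Longrightarrow> m = 0 \<and> m' = 0"
  by (cases k; cases b; cases b') (auto simp: corner_rel_def)

text \<open>
  The colours \<open>m1\<close>, \<open>m2\<close>, \<open>m3\<close> of the sides of a triangle are free parameters, from which all six
  ends are computed. After the flip every strand meets its two crossings in the opposite order, so
  each new side is computed from the ends in two ways, once at each of its corners, and the claim
  is that the two values agree. By cyclic symmetry the exceptional corner is the first one, and an
  over strand is the third strand.
\<close>

lemma triangle_flip_aux: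
  assumes types: "k23 = k31 \<and> (k31 = Virtual_Type \<or> k31 = Odd_Type) \<or>
      (k12 = Even_Positive \<or> k12 = Even_Negative) \<and>
      k23 = over_type (b2 \<noteq> b3) \<and> k31 = over_type (b3 = b1)"
    and corners: "corner_rel k12 b1 b2 m1 e1 i2 m2" "corner_rel k23 b2 b3 m2 e2 i3 m3"
      "corner_rel k31 b3 b1 m3 e3 i1 m1"
  shows "\<exists>n1 n2 n3. corner_rel k12 b1 b2 i1 n1 n2 e2 \<and> corner_rel k23 b2 b3 i2 n2 n3 e3
     \<and> corner_rel k31 b3 b1 i3 n3 n1 e1"
proof -
  define e1' i2' e2' i3' e3' i1' where defs:
    "e1' = corner_out k12 b1 b2 m1 m2" "i2' = corner_in k12 b1 b2 m1 m2"
    "e2' = corner_out k23 b2 b3 m2 m3" "i3' = corner_in k23 b2 b3 m2 m3"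
    "e3' = corner_out k31 b3 b1 m3 m1" "i1' = corner_in k31 b3 b1 m3 m1"
  have eqs: "e1 = e1'" "i2 = i2'" "e2 = e2'" "i3 = i3'" "e3 = e3'" "i1 = i1'"
    using corners by (simp_all add: corner_rel_iff defs)
  from types have "corner_out k12 b1 b2 i1' e2' = corner_in k31 b3 b1 i3' e1'
     \<and> corner_out k23 b2 b3 i2' e3' = corner_in k12 b1 b2 i1' e2'
     \<and> corner_out k31 b3 b1 i3' e1' = corner_in k23 b2 b3 i2' e3'"
  proof (elim disjE conjE)
    assume "k23 = k31" "k31 = Virtual_Type"
    then show ?thesis unfolding defs
      by (cases k12; cases b1; cases b2; cases b3; simp) (simp_all add: algebra_simps)
  next
    assume "k23 = k31" "k31 = Odd_Type"
    then show ?thesis unfolding defs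
      by (cases k12; cases b1; cases b2; cases b3; simp) (simp_all add: algebra_simps)
  next
    assume "k12 = Even_Positive" "k23 = over_type (b2 \<noteq> b3)" "k31 = over_type (b3 = b1)"
    then show ?thesis unfolding defs over_type_def
      by (cases b1; cases b2; cases b3; simp) (simp_all add: algebra_simps)
  next
    assume "k12 = Even_Negative" "k23 = over_type (b2 \<noteq> b3)" "k31 = over_type (b3 = b1)"
    then show ?thesis unfolding defs over_type_def
      by (cases b1; cases b2; cases b3; simp) (simp_all add: algebra_simps)
  qed
  then show ?thesis unfolding corner_rel_iff eqs by metis
qed

end

text \<open>
  The triangles that occur in moves: two corners rescale by the same unit, or all crossings are even
  and one of the three strands is over at both of its crossings. Two corners rescaling by the
  same unit also covers the case that all three of them rescale, as there are only two units.
\<close>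

definition flippable where
  "flippable k12 k23 k31 b1 b2 b3 \<longleftrightarrow>
     k23 = k31 \<and> (k31 = Virtual_Type \<or> k31 = Odd_Type) \<or>
     k31 = k12 \<and> (k12 = Virtual_Type \<or> k12 = Odd_Type) \<or>
     k12 = k23 \<and> (k23 = Virtual_Type \<or> k23 = Odd_Type) \<or>
     {k12, k23, k31} \<subseteq> {Even_Positive, Even_Negative} \<and>
       (k23 = over_type (b2 \<noteq> b3) \<and> k31 = over_type (b3 = b1) \<or>
        k31 = over_type (b3 \<noteq> b1) \<and> k12 = over_type (b1 = b2) \<or>
        k12 = over_type (b1 \<noteq> b2) \<and> k23 = over_type (b2 = b3))"

context colouring_units
begin

lemma triangle_flip:
  assumes types: "flippable k12 k23 k31 b1 b2 b3"
    and corners: "corner_rel k12 b1 b2 m1 e1 i2 m2" "corner_rel k23 b2 b3 m2 e2 i3 m3"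
      "corner_rel k31 b3 b1 m3 e3 i1 m1"
  shows "\<exists>n1 n2 n3. corner_rel k12 b1 b2 i1 n1 n2 e2 \<and> corner_rel k23 b2 b3 i2 n2 n3 e3
     \<and> corner_rel k31 b3 b1 i3 n3 n1 e1"
proof -
  consider
    "k23 = k31 \<and> (k31 = Virtual_Type \<or> k31 = Odd_Type) \<or>
      (k12 = Even_Positive \<or> k12 = Even_Negative) \<and>
      k23 = over_type (b2 \<noteq> b3) \<and> k31 = over_type (b3 = b1)"
  | "k31 = k12 \<and> (k12 = Virtual_Type \<or> k12 = Odd_Type) \<or>
      (k23 = Even_Positive \<or> k23 = Even_Negative) \<and>
      k31 = over_type (b3 \<noteq> b1) \<and> k12 = over_type (b1 = b2)"
  | "k12 = k23 \<and> (k23 = Virtual_Type \<or> k23 = Odd_Type) \<or>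
      (k31 = Even_Positive \<or> k31 = Even_Negative) \<and>
      k12 = over_type (b1 \<noteq> b2) \<and> k23 = over_type (b2 = b3)"
    using types unfolding flippable_def by blast
  then show ?thesis
  proof cases
    case 1
    from triangle_flip_aux [OF 1 corners] show ?thesis .
  next
    case 2
    from triangle_flip_aux [OF 2 corners(2,3,1)] show ?thesis by blast
  next
    case 3
    from triangle_flip_aux [OF 3 corners(3,1,2)] show ?thesis by blast
  qed
qed

end

section \<open>The parity of a crossing\<close>

definition classical_count :: "(nat \<Rightarrow> crossing_kind) \<Rightarrow> passage list \<Rightarrow> nat" where
  "classical_count \<kappa> w = length (filter (\<lambda>r. \<kappa> (fst r) \<noteq> Virtual) w)"

definition even_position :: "(nat \<Rightarrow> crossing_kind) \<Rightarrow> passage list \<Rightarrow> passage \<Rightarrow> bool" where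
  "even_position \<kappa> w p \<longleftrightarrow> even (classical_count \<kappa> (takeWhile (\<lambda>r. r \<noteq> p) w))"

lemma classical_count_simps [simp]:
  "classical_count \<kappa> [] = 0"
  "classical_count \<kappa> (p # w) = (if \<kappa> (fst p) = Virtual then 0 else 1) + classical_count \<kappa> w"
  "classical_count \<kappa> (u @ w) = classical_count \<kappa> u + classical_count \<kappa> w"
  by (simp_all add: classical_count_def)

lemma even_position_Cons [simp]:
  "even_position \<kappa> (r # w) p \<longleftrightarrow> p = r \<or> (\<kappa> (fst r) = Virtual \<longleftrightarrow> even_position \<kappa> w p)"
  by (auto simp: even_position_def)

lemma even_position_append [simp]:
  "even_position \<kappa> (u @ w) p \<longleftrightarrow>
     (if p \<in> set u then even_position \<kappa> u p
      else even (classical_count \<kappa> u) = even_position \<kappa> w p)"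
  by (induction u) auto

lemma opp_opp [simp]: "opp (opp e) = e" and opp_neq [simp]: "opp e \<noteq> e" "e \<noteq> opp e"
  by (cases e; simp)+

lemma entry_cases: "e' = e \<or> e' = opp e"
  by (cases e; cases e'; simp)

lemma well_formed_passage:
  assumes "well_formed w" "c \<in> fst ` set w"
  shows "(c, e) \<in> set w"
proof -
  from assms(2) obtain e' where "(c, e') \<in> set w" by auto
  moreover have "(c, opp e') \<in> set w"
    using assms(1) calculation by (auto simp: well_formed_def)
  ultimately show ?thesis using entry_cases [of e e'] by auto
qed

text \<open>
  If \<open>a\<close> and \<open>b\<close> classical passages precede the two passages of a classical crossing, then
  \<open>\<bar>a - b\<bar> - 1\<close> letters lie between its two occurrences. This form is symmetric in the two
  passages, and moves change the numbers \<open>a\<close> and \<open>b\<close> in a transparent way.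
\<close>

lemma odd_crossings_iff:
  assumes w: "well_formed w" and c: "c \<in> fst ` set w"
  shows "c \<in> odd_crossings (Diagram w \<kappa>) \<longleftrightarrow>
    \<kappa> c \<noteq> Virtual \<and> (even_position \<kappa> w (c, From_Left) \<longleftrightarrow> even_position \<kappa> w (c, From_Right))"
proof (cases "\<kappa> c = Virtual")
  case True
  then show ?thesis by (simp add: odd_crossings_def)
next
  case False
  have d: "distinct w" using w by (simp add: well_formed_def)
  from c obtain p where p: "p \<in> set w" "fst p = c" by blast
  from split_list_first [OF p(1)] obtain u w' where w1: "w = u @ p # w'" "p \<notin> set u" by blast
  obtain u e v e' x where split: "w = u @ (c, e) # v @ (c, e') # x" "e' = opp e"
  proof -
    have e0: "p = (c, snd p)" using p by (cases p) auto
    define e0 where "e0 = snd p"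
    note e0 = e0 [folded e0_def]
    have o: "(c, opp e0) \<in> set w" using well_formed_passage [OF w c] .
    then have "(c, opp e0) \<in> set u \<or> (c, opp e0) \<in> set w'"
      using w1 e0 by auto
    then show ?thesis
    proof
      assume "(c, opp e0) \<in> set u"
      then obtain u1 u2 where "u = u1 @ (c, opp e0) # u2" by (meson split_list)
      then show ?thesis using that [of u1 "opp e0" u2 e0 w'] w1 e0 by simp
    next
      assume "(c, opp e0) \<in> set w'"
      then obtain u1 u2 where "w' = u1 @ (c, opp e0) # u2" by (meson split_list)
      then show ?thesis using that [of u e0 u1 "opp e0" u2] w1 e0 by simp
    qed
  qed
  have notin: "c \<notin> fst ` set u" "c \<notin> fst ` set v"
  proof -
    have "(c, b) \<notin> set u \<and> (c, b) \<notin> set v" for b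
      using d split entry_cases [of b e] by auto
    then show "c \<notin> fst ` set u" "c \<notin> fst ` set v" by auto
  qed
  define fl where "fl = (\<lambda>l :: passage list. filter (\<lambda>c. \<kappa> c \<noteq> Virtual) (map fst l))"
  have word: "classical_word (Diagram w \<kappa>) = fl u @ c # fl v @ c # fl x"
    using False by (simp add: classical_word_def split fl_def)
  have nf: "c \<notin> set (fl u)" "c \<notin> set (fl v)" using notin by (auto simp: fl_def)
  have "dropWhile (\<lambda>d. d \<noteq> c) (fl u @ c # fl v @ c # fl x) = c # fl v @ c # fl x"
    using nf by (subst dropWhile_append2) auto
  moreover have "takeWhile (\<lambda>d. d \<noteq> c) (fl v @ c # fl x) = fl v"
    using nf by (subst takeWhile_append2) auto
  ultimately have "letters_between c (classical_word (Diagram w \<kappa>)) = fl v"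
    by (simp add: letters_between_def word)
  moreover have "length (fl v) = classical_count \<kappa> v"
    by (simp add: fl_def classical_count_def filter_map comp_def)
  ultimately have *: "c \<in> odd_crossings (Diagram w \<kappa>) \<longleftrightarrow> odd (classical_count \<kappa> v)"
    using False c by (simp add: odd_crossings_def crossings_def)
  have "(c, e) \<notin> set u" "(c, e') \<notin> set u" "(c, e') \<notin> set v" using notin by force+
  then have "even_position \<kappa> w (c, e) = even (classical_count \<kappa> u)"
    "even_position \<kappa> w (c, e') = (even (classical_count \<kappa> u) = odd (classical_count \<kappa> v))"
    using False split(2) unfolding split(1) by auto
  then have "odd (classical_count \<kappa> v) \<longleftrightarrow> (even_position \<kappa> w (c, e) \<longleftrightarrow> even_position \<kappa> w (c, e'))"
    by auto
  also have "\<dots> \<longleftrightarrow> (even_position \<kappa> w (c, From_Left) \<longleftrightarrow> even_position \<kappa> w (c, From_Right))"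
    using split(2) by (cases e) auto
  finally show ?thesis using * False by simp
qed

definition crossing_type :: "diagram \<Rightarrow> nat \<Rightarrow> crossing_type" where
  "crossing_type D c =
    (if kind D c = Virtual then Virtual_Type
     else if c \<in> odd_crossings D then Odd_Type
     else if kind D c = Positive then Even_Positive else Even_Negative)"

lemma crossing_type_cong:
  assumes "well_formed w" "c \<in> fst ` set w" "well_formed w'" "c' \<in> fst ` set w'"
    and "\<kappa>' c' = \<kappa> c"
    and "\<kappa> c \<noteq> Virtual \<Longrightarrow>
      (even_position \<kappa> w (c, From_Left) \<longleftrightarrow> even_position \<kappa> w (c, From_Right)) \<longleftrightarrow>
      (even_position \<kappa>' w' (c', From_Left) \<longleftrightarrow> even_position \<kappa>' w' (c', From_Right))"
  shows "crossing_type (Diagram w \<kappa>) c = crossing_type (Diagram w' \<kappa>') c'"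
  using assms by (auto simp: crossing_type_def odd_crossings_iff)

text \<open>
  Every classical crossing is passed twice. Hence moving the base point past a classical passage
  changes the parity of the position of every passage, the moved one included.
\<close>

lemma even_classical_count:
  assumes "well_formed w"
  shows "even (classical_count \<kappa> w)"
proof -
  let ?C = "{c \<in> fst ` set w. \<kappa> c \<noteq> Virtual}"
  have "set (filter (\<lambda>r. \<kappa> (fst r) \<noteq> Virtual) w) = ?C \<times> {From_Left, From_Right}"
  proof (rule Set.set_eqI)
    fix p :: passage
    obtain c e where "p = (c, e)" by (cases p)
    then show "p \<in> set (filter (\<lambda>r. \<kappa> (fst r) \<noteq> Virtual) w) \<longleftrightarrow> p \<in> ?C \<times> {From_Left, From_Right}"
      using well_formed_passage [OF assms, of c e] by (cases e) force+
  qed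
  then have "classical_count \<kappa> w = card (?C \<times> {From_Left, From_Right})"
    using assms unfolding classical_count_def well_formed_def
    by (metis distinct_card distinct_filter)
  also have "\<dots> = card ?C * 2" by (simp add: card_cartesian_product)
  finally show ?thesis by simp
qed

section \<open>Colourings of a diagram\<close>

text \<open>
  A colouring assigns to each passage the colours \<open>inc\<close> and \<open>out\<close> of the semi-arcs that lead to it
  and away from it; the predicate says that consecutive passages agree on the semi-arc between
  them, and that the path starts with colour \<open>a\<close> and ends with colour \<open>b\<close>. Unlike a function on the
  positions of the code, such a colouring need not be renumbered when passages are inserted,
  deleted or reordered.
\<close>

fun strand :: "(passage \<Rightarrow> 'a) \<Rightarrow> (passage \<Rightarrow> 'a) \<Rightarrow> 'a \<Rightarrow> passage list \<Rightarrow> 'a \<Rightarrow> bool" where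
  "strand inc out a [] b \<longleftrightarrow> a = b"
| "strand inc out a (p # w) b \<longleftrightarrow> inc p = a \<and> strand inc out (out p) w b"

lemma strand_append [simp]:
  "strand inc out a (u @ w) b \<longleftrightarrow> (\<exists>m. strand inc out a u m \<and> strand inc out m w b)"
  by (induction u arbitrary: a) auto

lemma strand_cong:
  assumes "\<And>p. p \<in> set w \<Longrightarrow> inc' p = inc p \<and> out' p = out p"
  shows "strand inc' out' a w b \<longleftrightarrow> strand inc out a w b"
  using assms by (induction w arbitrary: a) auto

lemma strand_map: "strand inc out a (map g w) b \<longleftrightarrow> strand (inc \<circ> g) (out \<circ> g) a w b"
  by (induction w arbitrary: a) auto

lemma strand_zero:
  assumes "strand inc out 0 w b" "\<forall>p \<in> set w. out p = 0"
  shows "b = 0"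
  using assms
proof (induction w)
  case (Cons p w)
  then show ?case by (cases w) auto
qed auto

context colouring_units
begin

definition crossing_coloured where
  "crossing_coloured D inc out c \<longleftrightarrow>
     crossing_rel (crossing_type D c) (inc (c, From_Left)) (inc (c, From_Right))
       (out (c, From_Right)) (out (c, From_Left))"

text \<open>
  The colour \<open>a\<close> of the semi-arc through the base point is kept separately, so that the diagram
  without crossings has the nonzero colourings of its closed arc.
\<close>

definition colourable :: "diagram \<Rightarrow> bool" where
  "colourable D \<longleftrightarrow> (\<exists>inc out a. strand inc out a (code D) a \<and>
     (\<forall>c \<in> crossings D. crossing_coloured D inc out c) \<and>
     (a \<noteq> 0 \<or> (\<exists>p \<in> set (code D). inc p \<noteq> 0 \<or> out p \<noteq> 0)))"

lemma colourableI:
  assumes "strand inc out a (code D) a" "\<And>c. c \<in> crossings D \<Longrightarrow> crossing_coloured D inc out c"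
   and "a = 0 \<Longrightarrow> \<forall>p \<in> set (code D). inc p = 0 \<and> out p = 0 \<Longrightarrow> False"
  shows "colourable D"
  using assms unfolding colourable_def by blast

lemma colourableE:
  assumes "colourable D"
  obtains inc out a where "strand inc out a (code D) a" "\<And>c. c \<in> crossings D \<Longrightarrow> crossing_coloured D inc out c"
   and "\<not> (a = 0 \<and> (\<forall>p \<in> set (code D). inc p = 0 \<and> out p = 0))"
  using assms unfolding colourable_def by blast

lemma crossing_coloured_cong:
  assumes "crossing_type D c = crossing_type D' c'"
    "\<And>e. inc (c, e) = inc' (c', e)" "\<And>e. out (c, e) = out' (c', e)"
  shows "crossing_coloured D inc out c = crossing_coloured D' inc' out' c'"
  using assms by (simp add: crossing_coloured_def)

end

section \<open>The first and the second Reidemeister move\<close>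

context colouring_units
begin

text \<open>
  At the crossing of a kink the outgoing end of one passage is the incoming end of the other one.
  Both relations then determine the colour of the loop from that of either outer end, so that the outer
  ends have equal colours. The two lemmas are the two sides on which the loop can lie.
\<close>

lemma kink_left:
  shows "crossing_rel k m n z n \<Longrightarrow> z = m \<and> (m = 0 \<longrightarrow> n = 0)" "\<exists>n. crossing_rel k m n m n"
proof -
  have *: "n = t' * m + (1 - s' * t') * n \<longleftrightarrow> n = s * m" for m n
  proof
    assume "n = t' * m + (1 - s' * t') * n"
    then have "s' * t' * n = t' * m" by (simp add: algebra_simps)
    then have "s * t * (s' * t' * n) = s * t * (t' * m)" by simp
    then show "n = s * m" by (simp add: ac_simps)
  qed (simp add: algebra_simps)
  show "crossing_rel k m n z n \<Longrightarrow> z = m \<and> (m = 0 \<longrightarrow> n = 0)"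
    by (cases k) (auto simp: * algebra_simps)
  show "\<exists>n. crossing_rel k m n m n"
    by (intro exI [of _ "case k of Virtual_Type \<Rightarrow> q * m | Odd_Type \<Rightarrow> \<theta> * m | _ \<Rightarrow> s * m"], cases k)
      (auto simp: algebra_simps)
qed

lemma kink_right:
  shows "crossing_rel k n m n w \<Longrightarrow> w = m \<and> (m = 0 \<longrightarrow> n = 0)" "\<exists>n. crossing_rel k n m n m"
proof -
  have *: "n = (1 - t * s) * n + t * m \<longleftrightarrow> n = s' * m" for m n
  proof
    assume "n = (1 - t * s) * n + t * m"
    then have "s * t * n = t * m" by (simp add: algebra_simps)
    then have "s' * t' * (s * t * n) = s' * t' * (t * m)" by simp
    then show "n = s' * m" by (simp add: ac_simps)
  qed (simp add: algebra_simps)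
  show "crossing_rel k n m n w \<Longrightarrow> w = m \<and> (m = 0 \<longrightarrow> n = 0)"
    by (cases k) (auto simp: * algebra_simps)
  show "\<exists>n. crossing_rel k n m n m"
    by (intro exI [of _ "case k of Virtual_Type \<Rightarrow> q' * m | Odd_Type \<Rightarrow> \<theta>' * m | _ \<Rightarrow> s' * m"], cases k)
      (auto simp: algebra_simps)
qed

text \<open>
  The common pattern of the first two moves, which delete the crossings \<open>C\<close>: a colouring restricts to
  the smaller diagram without becoming zero, and extends to the larger one by new values at the
  passages of \<open>C\<close> only.
\<close>

lemma colourable_remove:
  assumes C: "crossings (Diagram w' \<kappa>) = crossings (Diagram w \<kappa>) - C" "set w' \<subseteq> set w"
    and types: "\<And>c. c \<in> crossings (Diagram w' \<kappa>) \<Longrightarrow>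
      crossing_type (Diagram w \<kappa>) c = crossing_type (Diagram w' \<kappa>) c"
    and down: "\<And>inc out a. strand inc out a w a \<Longrightarrow>
      \<forall>c \<in> C. crossing_coloured (Diagram w \<kappa>) inc out c \<Longrightarrow>
      strand inc out a w' a \<and> (a = 0 \<and> (\<forall>p \<in> set w'. inc p = 0 \<and> out p = 0) \<longrightarrow>
        (\<forall>p \<in> set w. inc p = 0 \<and> out p = 0))"
    and up: "\<And>inc out a. strand inc out a w' a \<Longrightarrow>
      \<exists>inc' out'. (\<forall>p. fst p \<notin> C \<longrightarrow> inc' p = inc p \<and> out' p = out p) \<and>
        strand inc' out' a w a \<and> (\<forall>c \<in> C. crossing_coloured (Diagram w \<kappa>) inc' out' c)"
    and "C \<subseteq> crossings (Diagram w \<kappa>)"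
  shows "colourable (Diagram w \<kappa>) \<longleftrightarrow> colourable (Diagram w' \<kappa>)"
proof
  assume "colourable (Diagram w \<kappa>)"
  then obtain inc out a where *: "strand inc out a w a"
    "\<And>c. c \<in> crossings (Diagram w \<kappa>) \<Longrightarrow> crossing_coloured (Diagram w \<kappa>) inc out c"
    "\<not> (a = 0 \<and> (\<forall>p \<in> set w. inc p = 0 \<and> out p = 0))"
    by (elim colourableE) auto
  have "\<forall>c \<in> C. crossing_coloured (Diagram w \<kappa>) inc out c" using * assms(6) by auto
  note d = down [OF *(1) this]
  show "colourable (Diagram w' \<kappa>)"
  proof (rule colourableI)
    show "strand inc out a (code (Diagram w' \<kappa>)) a" using d by simp
    show "crossing_coloured (Diagram w' \<kappa>) inc out c" if "c \<in> crossings (Diagram w' \<kappa>)" for c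
      using *(2) [of c] that C types [OF that] by (simp add: crossing_coloured_def)
  qed (use d * in auto)
next
  assume "colourable (Diagram w' \<kappa>)"
  then obtain inc out a where *: "strand inc out a w' a"
    "\<And>c. c \<in> crossings (Diagram w' \<kappa>) \<Longrightarrow> crossing_coloured (Diagram w' \<kappa>) inc out c"
    "\<not> (a = 0 \<and> (\<forall>p \<in> set w'. inc p = 0 \<and> out p = 0))"
    by (elim colourableE) auto
  from up [OF *(1)] obtain inc' out' where
    new: "\<And>p. fst p \<notin> C \<Longrightarrow> inc' p = inc p \<and> out' p = out p"
    "strand inc' out' a w a" "\<And>c. c \<in> C \<Longrightarrow> crossing_coloured (Diagram w \<kappa>) inc' out' c"
    by blast
  show "colourable (Diagram w \<kappa>)"
  proof (rule colourableI)
    show "strand inc' out' a (code (Diagram w \<kappa>)) a" using new by simp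
    show "crossing_coloured (Diagram w \<kappa>) inc' out' c" if "c \<in> crossings (Diagram w \<kappa>)" for c
    proof (cases "c \<in> C")
      case True
      then show ?thesis by (rule new(3))
    next
      case False
      then have c: "c \<in> crossings (Diagram w' \<kappa>)" using that C by simp
      have "crossing_coloured (Diagram w \<kappa>) inc' out' c = crossing_coloured (Diagram w' \<kappa>) inc out c"
        by (rule crossing_coloured_cong [OF types [OF c]]) (use new(1) False in auto)
      then show ?thesis using *(2) [OF c] by simp
    qed
    show False if "a = 0" "\<forall>p\<in>set (code (Diagram w \<kappa>)). inc' p = 0 \<and> out' p = 0"
    proof -
      have "inc p = 0 \<and> out p = 0" if p: "p \<in> set w'" for p
      proof -
        have "fst p \<in> crossings (Diagram w' \<kappa>)" using p by (simp add: crossings_def)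
        then have "fst p \<notin> C" using C by simp
        from new(1) [OF this] show ?thesis using \<open>\<forall>p\<in>_. _\<close> p C(2) by auto
      qed
      then show False using * \<open>a = 0\<close> by blast
    qed
  qed
qed

lemma colourable_R1:
  assumes wf: "well_formed (u @ [(c, e), (c, opp e)] @ v)" "well_formed (u @ v)"
  shows "colourable (Diagram (u @ [(c, e), (c, opp e)] @ v) \<kappa>) \<longleftrightarrow> colourable (Diagram (u @ v) \<kappa>)"
proof (rule colourable_remove [where C = "{c}"])
  let ?w = "u @ [(c, e), (c, opp e)] @ v"
  let ?k = "crossing_type (Diagram ?w \<kappa>) c"
  have "(c, b) \<notin> set (u @ v)" for b
    using wf(1) entry_cases [of b e] by (auto simp: well_formed_def)
  then have c: "c \<notin> fst ` set (u @ v)" by force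
  then show "crossings (Diagram (u @ v) \<kappa>) = crossings (Diagram ?w \<kappa>) - {c}"
    by (auto simp: crossings_def)
  show "crossing_type (Diagram ?w \<kappa>) d = crossing_type (Diagram (u @ v) \<kappa>) d"
    if d: "d \<in> crossings (Diagram (u @ v) \<kappa>)" for d
  proof -
    have "d \<noteq> c" "d \<in> fst ` set ?w" "d \<in> fst ` set (u @ v)" using c d by (auto simp: crossings_def)
    then show ?thesis using wf by (intro crossing_type_cong) auto
  qed
  show "strand inc out a (u @ v) a \<and> (a = 0 \<and> (\<forall>p \<in> set (u @ v). inc p = 0 \<and> out p = 0) \<longrightarrow>
        (\<forall>p \<in> set ?w. inc p = 0 \<and> out p = 0))"
    if "strand inc out a ?w a" "\<forall>d \<in> {c}. crossing_coloured (Diagram ?w \<kappa>) inc out d"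
    for inc out a
  proof -
    define m where "m = inc (c, e)"
    have m: "strand inc out a u m" "inc (c, e) = m" "inc (c, opp e) = out (c, e)"
      "strand inc out (out (c, opp e)) v a" using that(1) by (auto simp: m_def)
    have k: "out (c, opp e) = m \<and> (m = 0 \<longrightarrow> out (c, e) = 0)"
      using that(2) m(2,3) kink_left(1) [of ?k] kink_right(1) [of ?k]
      by (cases e) (auto simp: crossing_coloured_def)
    have z: "m = 0" if "a = 0" "\<forall>p \<in> set (u @ v). out p = 0"
      using strand_zero [of inc out u m] m(1) that by auto
    show ?thesis using m k z by auto
  qed
  show "\<exists>inc' out'. (\<forall>p. fst p \<notin> {c} \<longrightarrow> inc' p = inc p \<and> out' p = out p) \<and>
        strand inc' out' a ?w a \<and> (\<forall>d \<in> {c}. crossing_coloured (Diagram ?w \<kappa>) inc' out' d)"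
    if st: "strand inc out a (u @ v) a" for inc out a
  proof -
    from st obtain m where m: "strand inc out a u m" "strand inc out m v a" by auto
    obtain n where n: "if e = From_Left then crossing_rel ?k m n m n
        else crossing_rel ?k n m n m"
      using kink_left(2) [of ?k m] kink_right(2) [of ?k m] by meson
    define inc' where "inc' = inc((c, e) := m, (c, opp e) := n)"
    define out' where "out' = out((c, e) := n, (c, opp e) := m)"
    have "inc' p = inc p \<and> out' p = out p" if "fst p \<noteq> c" for p
      using that by (auto simp: inc'_def out'_def)
    moreover have "strand inc' out' x u y = strand inc out x u y"
      "strand inc' out' x v y = strand inc out x v y" for x y
      using c by (intro strand_cong; force simp: inc'_def out'_def)+
    then have "strand inc' out' a ?w a"
      using m by (auto simp: inc'_def out'_def)
    moreover have "crossing_coloured (Diagram ?w \<kappa>) inc' out' c"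
      using n by (cases e) (auto simp: crossing_coloured_def inc'_def out'_def)
    ultimately show ?thesis by (intro exI [of _ inc'] exI [of _ out'] conjI) auto
  qed
qed (auto simp: crossings_def)

text \<open>
  The types of the two crossings of a bigon. Two odd crossings cancel whatever their signs are.
\<close>

definition cancelling :: "crossing_type \<Rightarrow> crossing_type \<Rightarrow> bool" where
  "cancelling k k' \<longleftrightarrow> (k, k') \<in> {(Virtual_Type, Virtual_Type), (Odd_Type, Odd_Type),
     (Even_Positive, Even_Negative), (Even_Negative, Even_Positive)}"

text \<open>
  Crossings of cancelling types undo each other, so the strands leave a bigon with the colours with which they
  entered it. The second strand may run parallel or antiparallel to the first one, and in the antiparallel
  case the two strands play different roles, which gives two mirror versions.
\<close>

lemma bigon_parallel:
  assumes "cancelling k k'"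
  shows "crossing_rel k a a' b' b \<Longrightarrow> crossing_rel k' b' b g g' \<Longrightarrow>
      g = a \<and> g' = a' \<and> (a = 0 \<and> a' = 0 \<longrightarrow> b = 0 \<and> b' = 0)"
    and "\<exists>b b'. crossing_rel k a a' b' b \<and> crossing_rel k' b' b a a'"
  using assms by (auto simp: cancelling_def) (simp_all add: algebra_simps)

lemma bigon_antiparallel_left:
  assumes "cancelling k k'"
  shows "crossing_rel k a b' g' b \<Longrightarrow> crossing_rel k' a' b g b' \<Longrightarrow>
      g = a \<and> g' = a' \<and> (a = 0 \<and> a' = 0 \<longrightarrow> b = 0 \<and> b' = 0)"
    and "\<exists>b b'. crossing_rel k a b' a' b \<and> crossing_rel k' a' b a b'"
  using assms by (auto simp: cancelling_def) (simp_all add: algebra_simps)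

lemma bigon_antiparallel_right:
  assumes "cancelling k k'"
  shows "crossing_rel k b' a b g' \<Longrightarrow> crossing_rel k' b a' b' g \<Longrightarrow>
      g = a \<and> g' = a' \<and> (a = 0 \<and> a' = 0 \<longrightarrow> b = 0 \<and> b' = 0)"
    and "\<exists>b b'. crossing_rel k b' a b a' \<and> crossing_rel k' b a' b' a"
  using assms by (auto simp: cancelling_def) (simp_all add: algebra_simps)

end

context colouring_units
begin

text \<open>
  The two passages \<open>p\<close> and \<open>r\<close> of the second strand come in either order, for the parallel and the
  antiparallel move.
\<close>

lemma colourable_R2:
  assumes wf: "well_formed (u @ [(c, e), (d, opp e)] @ v @ [p, r] @ w)" "well_formed (u @ v @ w)"
    and pr: "(p, r) = ((c, opp e), (d, e)) \<or> (p, r) = ((d, e), (c, opp e))"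
    and kinds: "r2_kinds \<kappa> (c, e) (d, opp e)"
  shows "colourable (Diagram (u @ [(c, e), (d, opp e)] @ v @ [p, r] @ w) \<kappa>) \<longleftrightarrow>
    colourable (Diagram (u @ v @ w) \<kappa>)"
proof (rule colourable_remove [where C = "{c, d}"])
  let ?w = "u @ [(c, e), (d, opp e)] @ v @ [p, r] @ w"
  let ?D = "Diagram ?w \<kappa>"
  have "(c, b) \<notin> set (u @ v @ w) \<and> (d, b) \<notin> set (u @ v @ w)" for b
    using wf(1) pr entry_cases [of b e] by (auto simp: well_formed_def)
  then have cd: "c \<notin> fst ` set (u @ v @ w)" "d \<notin> fst ` set (u @ v @ w)" by force+
  have neq: "c \<noteq> d" using wf(1) pr by (auto simp: well_formed_def)
  show "crossings (Diagram (u @ v @ w) \<kappa>) = crossings ?D - {c, d}"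
    using cd pr by (auto simp: crossings_def)
  have kind: "\<kappa> c = Virtual \<longleftrightarrow> \<kappa> d = Virtual" using kinds by (auto simp: r2_kinds_def)
  show "crossing_type ?D x = crossing_type (Diagram (u @ v @ w) \<kappa>) x"
    if x: "x \<in> crossings (Diagram (u @ v @ w) \<kappa>)" for x
  proof -
    have "x \<noteq> c" "x \<noteq> d" "x \<in> fst ` set ?w" "x \<in> fst ` set (u @ v @ w)"
      using cd x by (auto simp: crossings_def)
    moreover have "even_position \<kappa> ?w y = even_position \<kappa> (u @ v @ w) y" if "fst y = x" for y
    proof -
      have "y \<notin> {(c, e), (d, opp e), p, r}"
        using that \<open>x \<noteq> c\<close> \<open>x \<noteq> d\<close> pr by auto
      moreover have "\<kappa> (fst p) = Virtual \<longleftrightarrow> \<kappa> c = Virtual" "\<kappa> (fst r) = Virtual \<longleftrightarrow> \<kappa> c = Virtual"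
        using pr kind by auto
      ultimately show ?thesis using kind by (cases "\<kappa> d = Virtual") auto
    qed
    ultimately show ?thesis using wf by (intro crossing_type_cong) auto
  qed
  \<comment> \<open>The passages of the bigon come in adjacent pairs, so both crossings have the same parity.\<close>
  have cancel: "cancelling (crossing_type ?D c) (crossing_type ?D d)"
  proof -
    have in_w: "c \<in> fst ` set ?w" "d \<in> fst ` set ?w" using pr by force+
    note iff = odd_crossings_iff [OF wf(1) in_w(1), of \<kappa>] odd_crossings_iff [OF wf(1) in_w(2), of \<kappa>]
    have notin: "(c, b) \<notin> set u" "(d, b) \<notin> set u" "(c, b) \<notin> set v" "(d, b) \<notin> set v" for b
      using cd by force+
    define P where "P = even_position \<kappa> ?w"
    have "P (d, opp e) \<longleftrightarrow> (P (c, e) \<longleftrightarrow> \<kappa> c = Virtual)"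
      using notin neq unfolding P_def by auto
    moreover have "P r \<longleftrightarrow> (P p \<longleftrightarrow> \<kappa> c = Virtual)"
    proof -
      have "p \<noteq> r" "\<kappa> (fst p) = Virtual \<longleftrightarrow> \<kappa> c = Virtual" "p \<notin> {(c, e), (d, opp e)}"
        "r \<notin> {(c, e), (d, opp e)}" "p \<notin> set u" "p \<notin> set v" "r \<notin> set u" "r \<notin> set v"
        using pr neq kind notin by (elim disjE; simp)+
      then show ?thesis using kind unfolding P_def by auto
    qed
    ultimately have "(P (c, e) \<longleftrightarrow> P (c, opp e)) \<longleftrightarrow> (P (d, e) \<longleftrightarrow> P (d, opp e))"
      using pr by auto
    then have "c \<in> odd_crossings ?D \<longleftrightarrow> d \<in> odd_crossings ?D"
      unfolding iff P_def [symmetric] using kind by (cases e) auto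
    then show ?thesis
      using kinds by (cases e; cases "\<kappa> c"; cases "\<kappa> d")
        (auto simp: cancelling_def crossing_type_def r2_kinds_def is_over_def)
  qed
  show "strand inc out a (u @ v @ w) a \<and>
      (a = 0 \<and> (\<forall>p \<in> set (u @ v @ w). inc p = 0 \<and> out p = 0) \<longrightarrow>
        (\<forall>p \<in> set ?w. inc p = 0 \<and> out p = 0))"
    if st: "strand inc out a ?w a" and col: "\<forall>x \<in> {c, d}. crossing_coloured ?D inc out x"
    for inc out a
  proof -
    have st: "strand inc out a u (inc (c, e))" "inc (d, opp e) = out (c, e)"
      "strand inc out (out (d, opp e)) v (inc p)" "inc r = out p" "strand inc out (out r) w a"
      using st by auto
    have k: "out (d, opp e) = inc (c, e) \<and> out r = inc p \<and>
       (inc (c, e) = 0 \<and> inc p = 0 \<longrightarrow> out (c, e) = 0 \<and> out p = 0)"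
      using col pr st(2,4) bigon_parallel(1) [OF cancel] bigon_antiparallel_left(1) [OF cancel]
        bigon_antiparallel_right(1) [OF cancel]
      by (cases e) (elim disjE; simp add: crossing_coloured_def; metis)+
    have z: "inc (c, e) = 0 \<and> inc p = 0" if "a = 0" "\<forall>p \<in> set (u @ v @ w). out p = 0"
    proof -
      have "inc (c, e) = 0" using strand_zero [of inc out u] st(1) that by auto
      moreover then have "inc p = 0" using strand_zero [of inc out v] st(3) that k by auto
      ultimately show ?thesis by simp
    qed
    show ?thesis using st k z pr by auto
  qed
  show "\<exists>inc' out'. (\<forall>x. fst x \<notin> {c, d} \<longrightarrow> inc' x = inc x \<and> out' x = out x) \<and>
        strand inc' out' a ?w a \<and> (\<forall>x \<in> {c, d}. crossing_coloured ?D inc' out' x)"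
    if st: "strand inc out a (u @ v @ w) a" for inc out a
  proof -
    from st obtain m m' where m: "strand inc out a u m" "strand inc out m v m'"
      "strand inc out m' w a" by auto
    define inc' where "inc' n n' = inc((c, e) := m, (d, opp e) := n, p := m', r := n')" for n n'
    define out' where "out' n n' = out((c, e) := n, (d, opp e) := m, p := n', r := m')" for n n'
    have "\<exists>n n'. crossing_coloured ?D (inc' n n') (out' n n') c \<and>
        crossing_coloured ?D (inc' n n') (out' n n') d"
      using pr bigon_parallel(2) [OF cancel, of m m'] bigon_parallel(2) [OF cancel, of m' m]
        bigon_antiparallel_left(2) [OF cancel, of m m']
        bigon_antiparallel_right(2) [OF cancel, of m m']
      by (cases e)
        (elim disjE; simp add: crossing_coloured_def inc'_def out'_def neq neq [symmetric]; metis)+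
    then obtain n n' where n: "crossing_coloured ?D (inc' n n') (out' n n') c"
        "crossing_coloured ?D (inc' n n') (out' n n') d" by blast
    have same: "inc' n n' x = inc x \<and> out' n n' x = out x" if "fst x \<notin> {c, d}" for x
    proof -
      have "x \<notin> {(c, e), (d, opp e), p, r}" using that pr by auto
      then show ?thesis by (simp add: inc'_def out'_def)
    qed
    have segments: "strand (inc' n n') (out' n n') x u y = strand inc out x u y"
      "strand (inc' n n') (out' n n') x v y = strand inc out x v y"
      "strand (inc' n n') (out' n n') x w y = strand inc out x w y" for x y
      using cd by (intro strand_cong same; force)+
    have "distinct [(c, e), (d, opp e), p, r]" using wf(1) by (simp add: well_formed_def)
    then have ends: "inc' n n' (c, e) = m" "out' n n' (c, e) = n" "inc' n n' (d, opp e) = n"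
      "out' n n' (d, opp e) = m" "inc' n n' p = m'" "out' n n' p = n'" "inc' n n' r = n'"
      "out' n n' r = m'"
      by (simp_all add: inc'_def out'_def)
    have "strand (inc' n n') (out' n n') a ?w a"
      using m by (simp add: segments ends)
    then show ?thesis
      using n same by (intro exI [of _ "inc' n n'"] exI [of _ "out' n n'"] conjI) auto
  qed
qed (use pr in \<open>auto simp: crossings_def\<close>)

end

section \<open>Change of the base point and of the labels\<close>

context colouring_units
begin

lemma colourable_rotate1:
  assumes "well_formed (p # v)" "well_formed (v @ [p])"
  shows "colourable (Diagram (v @ [p]) \<kappa>) \<longleftrightarrow> colourable (Diagram (p # v) \<kappa>)"
proof -
  have p: "p \<notin> set v" using assms by (auto simp: well_formed_def)
  have total: "odd (classical_count \<kappa> v) \<longleftrightarrow> \<kappa> (fst p) \<noteq> Virtual"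
    using even_classical_count [OF assms(1), of \<kappa>] by (auto split: if_splits)
  have type: "crossing_type (Diagram (v @ [p]) \<kappa>) c = crossing_type (Diagram (p # v) \<kappa>) c"
    if "c \<in> fst ` set (p # v)" for c
  proof (rule crossing_type_cong)
    have "(c, b) = p \<or> (c, b) \<in> set v" for b
      using well_formed_passage [OF assms(1) that, of b] by auto
    note this [of From_Left] this [of From_Right]
    \<comment> \<open>Either all positions change their parity or none does.\<close>
    moreover have "even_position \<kappa> (v @ [p]) r = (even_position \<kappa> (p # v) r = (\<kappa> (fst p) = Virtual))"
      if "r = p \<or> r \<in> set v" for r
      using that p total by auto
    ultimately show "(even_position \<kappa> (v @ [p]) (c, From_Left) = even_position \<kappa> (v @ [p]) (c, From_Right)) =
      (even_position \<kappa> (p # v) (c, From_Left) = even_position \<kappa> (p # v) (c, From_Right))"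
      by auto
  qed (use assms that in auto)
  have cr: "crossings (Diagram (v @ [p]) \<kappa>) = fst ` set (p # v)"
     "crossings (Diagram (p # v) \<kappa>) = fst ` set (p # v)" by (auto simp: crossings_def)
  have col: "crossing_coloured (Diagram (v @ [p]) \<kappa>) inc out c = crossing_coloured (Diagram (p # v) \<kappa>) inc out c"
    if "c \<in> fst ` set (p # v)" for inc out c
    using type [OF that] by (intro crossing_coloured_cong) auto
  show ?thesis
  proof
    assume "colourable (Diagram (v @ [p]) \<kappa>)"
    then obtain inc out a where "strand inc out a (v @ [p]) a"
      "\<And>c. c \<in> fst ` set (p # v) \<Longrightarrow> crossing_coloured (Diagram (v @ [p]) \<kappa>) inc out c"
      "\<not> (a = 0 \<and> (\<forall>p \<in> set (v @ [p]). inc p = 0 \<and> out p = 0))"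
      by (elim colourableE) (auto simp: cr)
    then show "colourable (Diagram (p # v) \<kappa>)"
      by (intro colourableI [where a = "inc p" and inc = inc and out = out]) (auto simp: cr col)
  next
    assume "colourable (Diagram (p # v) \<kappa>)"
    then obtain inc out a where "strand inc out a (p # v) a"
      "\<And>c. c \<in> fst ` set (p # v) \<Longrightarrow> crossing_coloured (Diagram (p # v) \<kappa>) inc out c"
      "\<not> (a = 0 \<and> (\<forall>p \<in> set (p # v). inc p = 0 \<and> out p = 0))"
      by (elim colourableE) (auto simp: cr)
    then show "colourable (Diagram (v @ [p]) \<kappa>)"
      by (intro colourableI [where a = "out p" and inc = inc and out = out]) (auto simp: cr col)
  qed
qed

lemma well_formed_rotate: "well_formed (rotate m w) \<longleftrightarrow> well_formed w"
  by (simp add: well_formed_def)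

lemma colourable_rotate:
  assumes "well_formed w"
  shows "colourable (Diagram (rotate m w) \<kappa>) \<longleftrightarrow> colourable (Diagram w \<kappa>)"
proof (induction m)
  case (Suc m)
  show ?case
  proof (cases "rotate m w")
    case Nil
    then show ?thesis using Suc by simp
  next
    case (Cons p v)
    then have "rotate (Suc m) w = v @ [p]" by simp
    moreover have "well_formed (p # v)" "well_formed (v @ [p])"
      using assms calculation well_formed_rotate Cons by metis+
    ultimately show ?thesis using colourable_rotate1 [of p v \<kappa>] Suc Cons by metis
  qed
qed simp

lemma even_position_map:
  assumes "inj_on g (set w)" "p \<in> set w" "\<And>r. r \<in> set w \<Longrightarrow> \<kappa>' (fst (g r)) = \<kappa> (fst r)"
  shows "even_position \<kappa>' (map g w) (g p) = even_position \<kappa> w p"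
  using assms
proof (induction w)
  case (Cons r w)
  then show ?case by (cases "p = r") (auto simp: inj_on_def)
qed simp

lemma colourable_rename_aux:
  assumes w: "well_formed w" and f: "inj_on f (fst ` set w)"
    and \<kappa>: "\<And>c. c \<in> fst ` set w \<Longrightarrow> \<kappa>' (f c) = \<kappa> c"
    and w': "well_formed (map (\<lambda>(c, e). (f c, e)) w)"
    and col: "colourable (Diagram (map (\<lambda>(c, e). (f c, e)) w) \<kappa>')"
  shows "colourable (Diagram w \<kappa>)"
proof -
  define g :: "passage \<Rightarrow> passage" where "g = (\<lambda>(c, e). (f c, e))"
  have g: "g (c, e) = (f c, e)" for c e by (simp add: g_def)
  have g_fst: "fst (g r) = f (fst r)" for r by (cases r) (simp add: g)
  have inj: "inj_on g (set w)"
  proof (rule inj_onI)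
    fix x y assume "x \<in> set w" "y \<in> set w" "g x = g y"
    moreover have "snd (g r) = snd r" for r by (cases r) (simp add: g)
    ultimately show "x = y" using inj_onD [OF f, of "fst x" "fst y"] g_fst
      by (metis imageI prod_eqI)
  qed
  from col [folded g_def] obtain inc out a where *: "strand inc out a (map g w) a"
    "\<And>c. c \<in> crossings (Diagram (map g w) \<kappa>') \<Longrightarrow> crossing_coloured (Diagram (map g w) \<kappa>') inc out c"
    "\<not> (a = 0 \<and> (\<forall>p \<in> set (map g w). inc p = 0 \<and> out p = 0))"
    by (elim colourableE) auto
  show ?thesis
  proof (rule colourableI [where inc = "inc \<circ> g" and out = "out \<circ> g" and a = a])
    show "crossing_coloured (Diagram w \<kappa>) (inc \<circ> g) (out \<circ> g) c" if "c \<in> crossings (Diagram w \<kappa>)" for c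
    proof -
      have c: "c \<in> fst ` set w" using that by (simp add: crossings_def)
      obtain r where r: "r \<in> set w" "c = fst r" using c by blast
      have fc: "f c \<in> fst ` set (map g w)"
        unfolding r(2) g_fst [symmetric] using r(1) by simp
      have type: "crossing_type (Diagram w \<kappa>) c = crossing_type (Diagram (map g w) \<kappa>') (f c)"
      proof (rule crossing_type_cong)
        have "even_position \<kappa>' (map g w) (g (c, e)) = even_position \<kappa> w (c, e)" for e
          by (rule even_position_map [OF inj well_formed_passage [OF w c]]) (simp add: g_fst \<kappa>)
        then show "(even_position \<kappa> w (c, From_Left) \<longleftrightarrow> even_position \<kappa> w (c, From_Right)) \<longleftrightarrow>
          (even_position \<kappa>' (map g w) (f c, From_Left) \<longleftrightarrow> even_position \<kappa>' (map g w) (f c, From_Right))"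
          by (simp add: g)
      qed (use w c w' fc \<kappa> in \<open>auto simp: g_def\<close>)
      have "crossing_coloured (Diagram (map g w) \<kappa>') inc out (f c)"
        using *(2) [of "f c"] fc by (simp add: crossings_def)
      then show ?thesis using type by (simp add: crossing_coloured_def g)
    qed
  qed (use * in \<open>auto simp: strand_map\<close>)
qed

lemma colourable_rename:
  assumes w: "well_formed w" and f: "inj_on f (fst ` set w)"
    and \<kappa>: "\<And>c. c \<in> fst ` set w \<Longrightarrow> \<kappa>' (f c) = \<kappa> c"
    and w': "well_formed (map (\<lambda>(c, e). (f c, e)) w)"
  shows "colourable (Diagram (map (\<lambda>(c, e). (f c, e)) w) \<kappa>') \<longleftrightarrow> colourable (Diagram w \<kappa>)"
proof
  assume "colourable (Diagram w \<kappa>)"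
  let ?w = "map (\<lambda>(c, e). (f c, e)) w"
  define h where "h = inv_into (fst ` set w) f"
  have h: "h (f c) = c" if "c \<in> fst ` set w" for c using that f by (simp add: h_def)
  have set: "fst ` set ?w = f ` fst ` set w" by force
  have unrename: "map (\<lambda>(c, e). (h c, e)) ?w = w"
  proof -
    have "map ((\<lambda>(c, e). (h c, e)) \<circ> (\<lambda>(c, e). (f c, e))) w = w"
      by (rule map_idI) (use h in force)
    then show ?thesis by simp
  qed
  show "colourable (Diagram ?w \<kappa>')"
  proof (rule colourable_rename_aux [where f = h])
    show "inj_on h (fst ` set ?w)" unfolding set by (intro inj_onI) (metis h imageE)
    show "\<kappa> (h c) = \<kappa>' c" if "c \<in> fst ` set ?w" for c
      using that h \<kappa> unfolding set by (metis imageE)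
    show "colourable (Diagram (map (\<lambda>(c, e). (h c, e)) ?w) \<kappa>)"
      unfolding unrename by fact
  qed (use w w' unrename in simp_all)
qed (rule colourable_rename_aux [where f = f and \<kappa>' = \<kappa>', OF w f \<kappa> w'])

end

section \<open>Triangular faces\<close>

text \<open>
  The passages at a corner of a face, in the situation of \<open>corner_rel\<close>: \<open>x\<close> is the passage of the strand along
  which the boundary walk arrives, \<open>y\<close> the passage of the strand into which it turns left.
\<close>

definition meet :: "bool \<Rightarrow> passage \<Rightarrow> bool \<Rightarrow> passage \<Rightarrow> bool" where
  "meet b x b' y \<longleftrightarrow> fst y = fst x \<and>
     snd x = (if b = b' then From_Left else From_Right) \<and> snd y = opp (snd x)"

text \<open>
  A strand of a triangle with its two passages, \<open>y\<close> at the start and \<open>x\<close> at the end of a boundary walk along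
  it. The code lists them in the order of the knot, which \<open>b\<close> compares with that of the walk.
  Flipping the triangle negates \<open>b\<close> and keeps \<open>x\<close> and \<open>y\<close>.
\<close>

definition side :: "bool \<Rightarrow> passage \<Rightarrow> passage \<Rightarrow> passage list" where
  "side b y x = (if b then [y, x] else [x, y])"

text \<open>The colours before and after a passage in the direction of the boundary walk.\<close>

definition enter where "enter b inc out (p :: passage) = (if b then inc p else out p)"
definition leave where "leave b inc out (p :: passage) = (if b then out p else inc p)"

lemma strand_side:
  "strand inc out a (side b y x) a' \<longleftrightarrow>
     leave b inc out y = enter b inc out x \<and>
     a = (if b then enter b inc out y else leave b inc out x) \<and>
     a' = (if b then leave b inc out x else enter b inc out y)"
  by (auto simp: side_def enter_def leave_def)

lemma strand_side_opposite:
  "strand inc out a (side (\<not> b) y x) a' \<longleftrightarrow>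
     leave b inc out x = enter b inc out y \<and>
     a = (if b then enter b inc out x else leave b inc out y) \<and>
     a' = (if b then leave b inc out y else enter b inc out x)"
  by (auto simp: side_def enter_def leave_def)

lemma all_side: "(\<forall>p \<in> set (side b y x). inc p = 0 \<and> out p = 0) \<longleftrightarrow>
   enter b inc out x = 0 \<and> leave b inc out x = 0 \<and> enter b inc out y = 0 \<and> leave b inc out y = 0"
  by (auto simp: side_def enter_def leave_def)

context colouring_units
begin

lemma crossing_coloured_meet:
  assumes "meet b x b' y"
  shows "crossing_coloured D inc out (fst x) \<longleftrightarrow>
    corner_rel (crossing_type D (fst x)) b b' (enter b inc out x) (leave b inc out x)
      (enter b' inc out y) (leave b' inc out y)"
proof -
  have "x = (fst x, if b = b' then From_Left else From_Right)"
    "y = (fst x, if b = b' then From_Right else From_Left)"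
    using assms by (auto simp: meet_def prod_eq_iff)
  then obtain c where "x = (c, if b = b' then From_Left else From_Right)"
    "y = (c, if b = b' then From_Right else From_Left)" by metis
  then show ?thesis
    by (cases b; cases b') (simp_all add: crossing_coloured_def corner_rel_def enter_def leave_def)
qed

text \<open>
  Every colouring near a triangle \<open>T\<close> of \<open>D\<close> is matched by one of \<open>D'\<close>, in which the strands pass
  their crossings in the opposite order, with the same colours at the outer ends. The last
  conjunct keeps nonzero colourings nonzero. The triangle is a set of strands because the strands
  need not occur in the code in their cyclic order around the face.
\<close>

definition recolourable :: "diagram \<Rightarrow> diagram \<Rightarrow> (bool \<times> passage \<times> passage) set \<Rightarrow> bool" where
  "recolourable D D' T \<longleftrightarrow> (\<forall>inc out.
    (\<forall>(b, y, x) \<in> T. leave b inc out y = enter b inc out x \<and> crossing_coloured D inc out (fst x)) \<longrightarrow>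
    (\<exists>inc' out'.
      (\<forall>p. (\<forall>(b, y, x) \<in> T. p \<noteq> x \<and> p \<noteq> y) \<longrightarrow> inc' p = inc p \<and> out' p = out p) \<and>
      (\<forall>(b, y, x) \<in> T. crossing_coloured D' inc' out' (fst x) \<and>
        enter b inc' out' x = enter b inc out y \<and> leave b inc' out' y = leave b inc out x \<and>
        leave b inc' out' x = enter b inc' out' y) \<and>
      ((\<forall>(b, y, x) \<in> T. enter b inc out y = 0 \<and> leave b inc out x = 0) \<longrightarrow>
       (\<forall>(b, y, x) \<in> T. leave b inc out y = 0))))"

lemma recolour_triangle:
  assumes meet: "meet b1 x1 b2 y2" "meet b2 x2 b3 y3" "meet b3 x3 b1 y1"
    and distinct: "distinct [x1, y1, x2, y2, x3, y3]"
    and flip: "flippable (crossing_type D (fst x1)) (crossing_type D (fst x2))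
      (crossing_type D (fst x3)) b1 b2 b3"
    and types: "\<And>c. c \<in> {fst x1, fst x2, fst x3} \<Longrightarrow> crossing_type D' c = crossing_type D c"
  shows "recolourable D D' {(b1, y1, x1), (b2, y2, x2), (b3, y3, x3)}"
  unfolding recolourable_def
proof (intro allI impI)
  fix inc out :: "passage \<Rightarrow> 'a"
  let ?T = "{(b1, y1, x1), (b2, y2, x2), (b3, y3, x3)}"
  assume "\<forall>(b, y, x) \<in> ?T. leave b inc out y = enter b inc out x \<and> crossing_coloured D inc out (fst x)"
  then have arcs: "leave b1 inc out y1 = enter b1 inc out x1" "leave b2 inc out y2 = enter b2 inc out x2"
      "leave b3 inc out y3 = enter b3 inc out x3"
    and col: "crossing_coloured D inc out (fst x1)" "crossing_coloured D inc out (fst x2)"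
      "crossing_coloured D inc out (fst x3)" by auto
  define m1 m2 m3 where m: "m1 = enter b1 inc out x1" "m2 = enter b2 inc out x2"
    "m3 = enter b3 inc out x3"
  define i1 i2 i3 where i: "i1 = enter b1 inc out y1" "i2 = enter b2 inc out y2"
    "i3 = enter b3 inc out y3"
  define e1 e2 e3 where e: "e1 = leave b1 inc out x1" "e2 = leave b2 inc out x2"
    "e3 = leave b3 inc out x3"
  have corners:
    "corner_rel (crossing_type D (fst x1)) b1 b2 m1 e1 i2 m2"
    "corner_rel (crossing_type D (fst x2)) b2 b3 m2 e2 i3 m3"
    "corner_rel (crossing_type D (fst x3)) b3 b1 m3 e3 i1 m1"
    using col unfolding crossing_coloured_meet [OF meet(1)] crossing_coloured_meet [OF meet(2)]
      crossing_coloured_meet [OF meet(3)] arcs m i e by simp_all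
  from triangle_flip [OF flip corners] obtain n1 n2 n3 where n:
    "corner_rel (crossing_type D (fst x1)) b1 b2 i1 n1 n2 e2"
    "corner_rel (crossing_type D (fst x2)) b2 b3 i2 n2 n3 e3"
    "corner_rel (crossing_type D (fst x3)) b3 b1 i3 n3 n1 e1" by blast
  define inc' where "inc' = inc(
     x1 := if b1 then i1 else n1, y1 := if b1 then n1 else e1,
     x2 := if b2 then i2 else n2, y2 := if b2 then n2 else e2,
     x3 := if b3 then i3 else n3, y3 := if b3 then n3 else e3)"
  define out' where "out' = out(
     x1 := if b1 then n1 else i1, y1 := if b1 then e1 else n1,
     x2 := if b2 then n2 else i2, y2 := if b2 then e2 else n2,
     x3 := if b3 then n3 else i3, y3 := if b3 then e3 else n3)"
  have new: "enter b1 inc' out' x1 = i1" "leave b1 inc' out' x1 = n1"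
      "enter b1 inc' out' y1 = n1" "leave b1 inc' out' y1 = e1"
      "enter b2 inc' out' x2 = i2" "leave b2 inc' out' x2 = n2"
      "enter b2 inc' out' y2 = n2" "leave b2 inc' out' y2 = e2"
      "enter b3 inc' out' x3 = i3" "leave b3 inc' out' x3 = n3"
      "enter b3 inc' out' y3 = n3" "leave b3 inc' out' y3 = e3"
    using distinct by (simp_all add: enter_def leave_def inc'_def out'_def)
  have coloured: "crossing_coloured D' inc' out' (fst x1)" "crossing_coloured D' inc' out' (fst x2)"
    "crossing_coloured D' inc' out' (fst x3)"
    using n types unfolding crossing_coloured_meet [OF meet(1)] crossing_coloured_meet [OF meet(2)]
      crossing_coloured_meet [OF meet(3)] new by simp_all
  \<comment> \<open>The ends of a corner determine its sides, so the colours inside vanish with those outside.\<close>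
  have zero: "m1 = 0 \<and> m2 = 0 \<and> m3 = 0"
    if "i1 = 0" "i2 = 0" "i3 = 0" "e1 = 0" "e2 = 0" "e3 = 0"
    using corners(1,2) corner_rel_zero [of _ b1 b2 m1 m2] corner_rel_zero [of _ b2 b3 m2 m3]
    unfolding that by blast
  show "\<exists>inc' out'.
      (\<forall>p. (\<forall>(b, y, x) \<in> ?T. p \<noteq> x \<and> p \<noteq> y) \<longrightarrow> inc' p = inc p \<and> out' p = out p) \<and>
      (\<forall>(b, y, x) \<in> ?T. crossing_coloured D' inc' out' (fst x) \<and>
        enter b inc' out' x = enter b inc out y \<and> leave b inc' out' y = leave b inc out x \<and>
        leave b inc' out' x = enter b inc' out' y) \<and>
      ((\<forall>(b, y, x) \<in> ?T. enter b inc out y = 0 \<and> leave b inc out x = 0) \<longrightarrow>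
       (\<forall>(b, y, x) \<in> ?T. leave b inc out y = 0))"
  proof (rule exI [of _ inc'], rule exI [of _ out'], intro conjI)
    show "\<forall>p. (\<forall>(b, y, x) \<in> ?T. p \<noteq> x \<and> p \<noteq> y) \<longrightarrow> inc' p = inc p \<and> out' p = out p"
      by (simp add: inc'_def out'_def)
    show "\<forall>(b, y, x) \<in> ?T. crossing_coloured D' inc' out' (fst x) \<and>
        enter b inc' out' x = enter b inc out y \<and> leave b inc' out' y = leave b inc out x \<and>
        leave b inc' out' x = enter b inc' out' y"
      using coloured new by (simp add: i e)
    show "(\<forall>(b, y, x) \<in> ?T. enter b inc out y = 0 \<and> leave b inc out x = 0) \<longrightarrow>
       (\<forall>(b, y, x) \<in> ?T. leave b inc out y = 0)"
      using zero by (simp add: i e m arcs)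
  qed
qed

end

lemma position_eq:
  assumes "distinct w" "w = u @ p # v"
  shows "position w p = length u"
  using assms(1) unfolding position_def assms(2) by (subst takeWhile_append2) auto

lemma nth_position:
  assumes "p \<in> set w"
  shows "w ! position w p = p" "position w p < length w"
proof -
  from split_list_first [OF assms] obtain u v where w: "w = u @ p # v" "p \<notin> set u" by blast
  then have "position w p = length u"
    unfolding position_def by (subst w(1), subst takeWhile_append2) auto
  then show "w ! position w p = p" "position w p < length w" using w(1) by simp_all
qed

text \<open>
  A step of the boundary walk from the semi-arc between \<open>p\<close> and \<open>p'\<close> to the one between \<open>r\<close> and \<open>r'\<close>. Since a
  semi-arc is determined by either of its ends, this identifies the passage at the start of the
  next side.
\<close>

lemma face_step_meet:
  assumes w: "well_formed w" "w = u @ [p, p'] @ v" "w = u' @ [r, r'] @ v'"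
    and step: "face_step w (out_arc w p, b) = (out_arc w r, b')"
  shows "meet b (if b then p' else p) b' (if b' then r else r')"
proof -
  have d: "distinct w" using w by (simp add: well_formed_def)
  have pos: "position w p = length u" "position w p' = Suc (length u)"
      "position w r = length u'" "position w r' = Suc (length u')"
    using position_eq [of w u p "p' # v"] position_eq [of w "u @ [p]" p' v]
      position_eq [of w u' r "r' # v'"] position_eq [of w "u' @ [r]" r' v'] d w(2,3)
    by auto
  have len: "Suc (length u) < length w" "Suc (length u') < length w"
    by (simp add: w(2), simp add: w(3))
  have nth: "w ! length u = p" "w ! Suc (length u) = p'"
    unfolding w(2) by (simp_all add: nth_append)
  have mem: "p \<in> set w" "p' \<in> set w"
    by (simp_all add: w(2))
  have mem': "r \<in> set w" "r' \<in> set w"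
    by (simp_all add: w(3))
  have inj: "x = y" if "position w x = position w y" "x \<in> set w" "y \<in> set w" for x y
  proof -
    have "w ! position w x = w ! position w y" using that(1) by simp
    then show ?thesis using nth_position(1) that(2,3) by simp
  qed
  have partner: "(fst x, opp (snd x)) \<in> set w" if "x \<in> set w" for x
    using well_formed_passage [OF w(1)] that by blast
  have out: "x = r" if "out_arc w x = out_arc w r" "x \<in> set w" for x
    using inj [of x r] that mem' by (simp add: out_arc_def)
  have inc: "x = r'" if "in_arc w x = out_arc w r" "x \<in> set w" for x
  proof -
    have less: "position w x < length w" using nth_position(2) [OF that(2)] .
    have "(position w x + length w - 1) mod length w = length u'"
      using that(1) by (simp add: in_arc_def out_arc_def pos)
    then have "position w x = Suc (length u')"
      using less len(2)
      by (cases "position w x") (auto simp: mod_if)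
    then show ?thesis using inj [of x r'] that mem' pos by simp
  qed
  show ?thesis
  proof (cases b)
    case True
    have "face_step w (out_arc w p, True) = (case p' of
       (c, From_Left) \<Rightarrow> (out_arc w (c, From_Right), True)
     | (c, From_Right) \<Rightarrow> (in_arc w (c, From_Left), False))"
      using len(1) nth by (simp add: out_arc_def [of w p] pos)
    with step True have step': "(out_arc w r, b') = (case p' of
       (c, From_Left) \<Rightarrow> (out_arc w (c, From_Right), True)
     | (c, From_Right) \<Rightarrow> (in_arc w (c, From_Left), False))" by simp
    show ?thesis
    proof (cases "snd p'")
      case From_Left
      then have "out_arc w (fst p', From_Right) = out_arc w r" "b'"
        using step' by (auto simp: case_prod_beta)
      moreover have "(fst p', From_Right) = r"
        using calculation(1) partner [OF mem(2)] From_Left by (intro out) simp_all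
      ultimately show ?thesis using True From_Left by (auto simp: meet_def)
    next
      case From_Right
      then have "in_arc w (fst p', From_Left) = out_arc w r" "\<not> b'"
        using step' by (auto simp: case_prod_beta)
      moreover have "(fst p', From_Left) = r'"
        using calculation(1) partner [OF mem(2)] From_Right by (intro inc) simp_all
      ultimately show ?thesis using True From_Right by (auto simp: meet_def)
    qed
  next
    case False
    have "face_step w (out_arc w p, False) = (case p of
       (c, From_Left) \<Rightarrow> (in_arc w (c, From_Right), False)
     | (c, From_Right) \<Rightarrow> (out_arc w (c, From_Left), True))"
      using nth by (simp add: out_arc_def [of w p] pos)
    with step False have step': "(out_arc w r, b') = (case p of
       (c, From_Left) \<Rightarrow> (in_arc w (c, From_Right), False)
     | (c, From_Right) \<Rightarrow> (out_arc w (c, From_Left), True))" by simp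
    show ?thesis
    proof (cases "snd p")
      case From_Left
      then have "in_arc w (fst p, From_Right) = out_arc w r" "\<not> b'"
        using step' by (auto simp: case_prod_beta)
      moreover have "(fst p, From_Right) = r'"
        using calculation(1) partner [OF mem(1)] From_Left by (intro inc) simp_all
      ultimately show ?thesis using False From_Left by (auto simp: meet_def)
    next
      case From_Right
      then have "out_arc w (fst p, From_Left) = out_arc w r" "b'"
        using step' by (auto simp: case_prod_beta)
      moreover have "(fst p, From_Left) = r"
        using calculation(1) partner [OF mem(1)] From_Right by (intro out) simp_all
      ultimately show ?thesis using False From_Right by (auto simp: meet_def)
    qed
  qed
qed

text \<open>
  On an orbit with three elements, an injective map is a 3-cycle: it has no fixed point, as the orbit
  would stay inside the fixed point or inside its complement.
\<close>

lemma three_element_orbit: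
  assumes orbit: "{d1, d2, d3} = {(f ^^ k) d | k. True}"
    and distinct: "distinct [d1, d2, d3]" and inj: "inj_on f {d1, d2, d3}"
  shows "f d1 = d2 \<and> f d2 = d3 \<and> f d3 = d1 \<or> f d1 = d3 \<and> f d3 = d2 \<and> f d2 = d1"
proof -
  have "f x \<in> {(f ^^ k) d | k. True}" if x: "x \<in> {(f ^^ k) d | k. True}" for x
  proof -
    from x obtain k where "x = (f ^^ k) d" by blast
    then have "f x = (f ^^ Suc k) d" by simp
    then show ?thesis by blast
  qed
  then have closed: "f x \<in> {d1, d2, d3}" if "x \<in> {d1, d2, d3}" for x
    using that unfolding orbit by blast
  have all: "{d1, d2, d3} \<subseteq> B" if "d \<in> B" "f ` B \<subseteq> B" for B
  proof -
    have "(f ^^ k) d \<in> B" for k using that by (induction k) auto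
    then show ?thesis unfolding orbit by blast
  qed
  have "(f ^^ 0) d \<in> {d1, d2, d3}" unfolding orbit by blast
  then have d: "d \<in> {d1, d2, d3}" by simp
  have no_fixpoint: "f x \<noteq> x" if x: "x \<in> {d1, d2, d3}" for x
  proof
    assume fix_x: "f x = x"
    have "d \<noteq> x"
    proof
      assume "d = x"
      then have "{d1, d2, d3} \<subseteq> {x}" using fix_x by (intro all) auto
      then show False using distinct by auto
    qed
    moreover have "f ` ({d1, d2, d3} - {x}) \<subseteq> {d1, d2, d3} - {x}"
    proof (rule image_subsetI)
      fix y assume y: "y \<in> {d1, d2, d3} - {x}"
      then have "f y \<in> {d1, d2, d3}" using closed [of y] by blast
      moreover have "f y \<noteq> x"
      proof
        assume "f y = x"
        then have "f y = f x" using fix_x by simp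
        from inj_onD [OF inj this] y x show False by blast
      qed
      ultimately show "f y \<in> {d1, d2, d3} - {x}" by blast
    qed
    ultimately have "{d1, d2, d3} \<subseteq> {d1, d2, d3} - {x}" using d by (intro all) auto
    then show False using x by blast
  qed
  have "f d1 \<in> {d2, d3}" "f d2 \<in> {d1, d3}" "f d3 \<in> {d1, d2}"
    using closed [of d1] closed [of d2] closed [of d3] no_fixpoint by auto
  moreover have "f d1 \<noteq> f d2" "f d2 \<noteq> f d3" "f d3 \<noteq> f d1"
    using inj distinct by (auto simp: inj_on_def)
  ultimately show ?thesis by auto
qed

lemma meet_opposite: "meet (\<not> b) x (\<not> b') y = meet b x b' y"
  by (simp add: meet_def)

lemma meet_entries:
  assumes "meet b x b' y"
  shows "{x, y} = {(fst x, From_Left), (fst x, From_Right)}"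
  using assms by (cases x; cases y) (auto simp: meet_def split: if_splits)

lemma odd_crossings_meet:
  assumes "meet b x b' y" "well_formed w" "x \<in> set w"
  shows "fst x \<in> odd_crossings (Diagram w \<kappa>) \<longleftrightarrow>
    \<kappa> (fst x) \<noteq> Virtual \<and> (even_position \<kappa> w x \<longleftrightarrow> even_position \<kappa> w y)"
proof -
  have "fst x \<in> fst ` set w" using assms(3) by simp
  note iff = odd_crossings_iff [OF assms(2) this, of \<kappa>]
  have "x = (fst x, From_Left) \<and> y = (fst x, From_Right) \<or> x = (fst x, From_Right) \<and> y = (fst x, From_Left)"
    using assms(1) by (cases x; cases y) (auto simp: meet_def split: if_splits)
  then show ?thesis unfolding iff by metis
qed

lemma over_type_meet:
  assumes "meet b x b' y" "fst x \<notin> odd_crossings (Diagram w \<kappa>)"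
  shows "is_over \<kappa> x \<Longrightarrow> crossing_type (Diagram w \<kappa>) (fst x) = over_type (b = b')"
    and "is_over \<kappa> y \<Longrightarrow> crossing_type (Diagram w \<kappa>) (fst x) = over_type (b \<noteq> b')"
  using assms by (auto simp: meet_def is_over_def crossing_type_def over_type_def split: if_splits)

text \<open>
  Parity enters here. On each strand of a classical triangle the two passages are adjacent, so their
  positions have different parities; going around the triangle, the number of corners that join
  positions of equal parity is even. If it is not zero, two corners are odd and rescale by the
  same unit \<open>\<theta>\<close>. Otherwise all crossings are even and the over strand required by the move remains.
\<close>

lemma flippable_triangle:
  assumes w: "well_formed w" "{x1, y1, x2, y2, x3, y3} \<subseteq> set w"
    and meet: "meet b1 x1 b2 y2" "meet b2 x2 b3 y3" "meet b3 x3 b1 y1"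
    and alternate: "\<And>x y. (x, y) \<in> {(x1, y1), (x2, y2), (x3, y3)} \<Longrightarrow>
      \<kappa> (fst x) \<noteq> Virtual \<Longrightarrow> \<kappa> (fst y) \<noteq> Virtual \<Longrightarrow>
      even_position \<kappa> w x \<noteq> even_position \<kappa> w y"
    and neq: "fst x1 \<noteq> fst x2" "fst x2 \<noteq> fst x3" "fst x3 \<noteq> fst x1"
    and kinds: "(\<forall>c \<in> {fst x1, fst x2, fst x3}. \<kappa> c = Virtual) \<or>
      (\<exists>c \<in> {fst x1, fst x2, fst x3}. \<forall>c' \<in> {fst x1, fst x2, fst x3}. \<kappa> c' \<noteq> Virtual \<longleftrightarrow> c' = c) \<or>
      (\<forall>c \<in> {fst x1, fst x2, fst x3}. \<kappa> c \<noteq> Virtual) \<and>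
      (\<exists>(x, y) \<in> {(x1, y1), (x2, y2), (x3, y3)}. is_over \<kappa> x \<and> is_over \<kappa> y)"
  shows "flippable (crossing_type (Diagram w \<kappa>) (fst x1)) (crossing_type (Diagram w \<kappa>) (fst x2))
    (crossing_type (Diagram w \<kappa>) (fst x3)) b1 b2 b3"
proof -
  let ?D = "Diagram w \<kappa>"
  have virt: "crossing_type ?D c = Virtual_Type" if "\<kappa> c = Virtual" for c
    using that by (simp add: crossing_type_def)
  have odd_type: "crossing_type ?D c = Odd_Type" if "c \<in> odd_crossings ?D" for c
    using that by (simp add: crossing_type_def odd_crossings_def)
  have even_type: "crossing_type ?D c \<in> {Even_Positive, Even_Negative}"
    if "c \<notin> odd_crossings ?D" "\<kappa> c \<noteq> Virtual" for c
    using that by (simp add: crossing_type_def)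
  have fst_y: "fst y2 = fst x1" "fst y3 = fst x2" "fst y1 = fst x3"
    using meet by (auto simp: meet_def)
  from kinds consider (two) "\<exists>c \<in> {fst x1, fst x2, fst x3}. \<forall>c' \<in> {fst x1, fst x2, fst x3}. c' \<noteq> c \<longrightarrow> \<kappa> c' = Virtual"
    | (classical) "\<kappa> (fst x1) \<noteq> Virtual" "\<kappa> (fst x2) \<noteq> Virtual" "\<kappa> (fst x3) \<noteq> Virtual"
      "is_over \<kappa> x1 \<and> is_over \<kappa> y1 \<or> is_over \<kappa> x2 \<and> is_over \<kappa> y2 \<or> is_over \<kappa> x3 \<and> is_over \<kappa> y3"
    by (elim disjE) auto
  then show ?thesis
  proof cases
    case two
    then obtain c where c: "c \<in> {fst x1, fst x2, fst x3}"
      "\<And>c'. c' \<in> {fst x1, fst x2, fst x3} \<Longrightarrow> c' \<noteq> c \<Longrightarrow> \<kappa> c' = Virtual" by blast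
    have "\<kappa> (fst x1) = Virtual \<or> fst x1 = c" "\<kappa> (fst x2) = Virtual \<or> fst x2 = c"
      "\<kappa> (fst x3) = Virtual \<or> fst x3 = c" using c(2) by blast+
    then have "\<kappa> (fst x1) = Virtual \<and> \<kappa> (fst x2) = Virtual \<or>
        \<kappa> (fst x2) = Virtual \<and> \<kappa> (fst x3) = Virtual \<or> \<kappa> (fst x3) = Virtual \<and> \<kappa> (fst x1) = Virtual"
      using neq by metis
    then show ?thesis using virt unfolding flippable_def by metis
  next
    case classical
    have "even_position \<kappa> w x1 \<noteq> even_position \<kappa> w y1" "even_position \<kappa> w x2 \<noteq> even_position \<kappa> w y2"
      "even_position \<kappa> w x3 \<noteq> even_position \<kappa> w y3"
      using alternate [of x1 y1] alternate [of x2 y2] alternate [of x3 y3] classical fst_y by auto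
    moreover have "fst x1 \<in> odd_crossings ?D \<longleftrightarrow> even_position \<kappa> w x1 = even_position \<kappa> w y2"
      "fst x2 \<in> odd_crossings ?D \<longleftrightarrow> even_position \<kappa> w x2 = even_position \<kappa> w y3"
      "fst x3 \<in> odd_crossings ?D \<longleftrightarrow> even_position \<kappa> w x3 = even_position \<kappa> w y1"
      using odd_crossings_meet [OF meet(1) w(1), of \<kappa>] odd_crossings_meet [OF meet(2) w(1), of \<kappa>]
        odd_crossings_meet [OF meet(3) w(1), of \<kappa>] w(2) classical(1-3) by simp_all
    ultimately consider (odd) "fst x1 \<in> odd_crossings ?D \<and> fst x2 \<in> odd_crossings ?D \<or>
        fst x2 \<in> odd_crossings ?D \<and> fst x3 \<in> odd_crossings ?D \<or>
        fst x3 \<in> odd_crossings ?D \<and> fst x1 \<in> odd_crossings ?D"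
      | (even) "fst x1 \<notin> odd_crossings ?D" "fst x2 \<notin> odd_crossings ?D" "fst x3 \<notin> odd_crossings ?D"
      by blast
    then show ?thesis
    proof cases
      case odd
      then show ?thesis using odd_type unfolding flippable_def by metis
    next
      case even
      have "{crossing_type ?D (fst x1), crossing_type ?D (fst x2), crossing_type ?D (fst x3)}
        \<subseteq> {Even_Positive, Even_Negative}"
        using even_type even classical by blast
      then show ?thesis
        using classical(4) over_type_meet [OF meet(1) even(1)] over_type_meet [OF meet(2) even(2)]
          over_type_meet [OF meet(3) even(3)]
        unfolding flippable_def by metis
    qed
  qed
qed

lemma even_position_swap:
  assumes "distinct (u @ [p, p'] @ v)"
  shows "even_position \<kappa> (u @ [p', p] @ v) r =
    (if r = p then even_position \<kappa> (u @ [p, p'] @ v) p \<longleftrightarrow> \<kappa> (fst p') = Virtual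
     else if r = p' then even_position \<kappa> (u @ [p, p'] @ v) p' \<longleftrightarrow> \<kappa> (fst p) = Virtual
     else even_position \<kappa> (u @ [p, p'] @ v) r)"
  using assms by (cases "\<kappa> (fst p) = Virtual"; cases "\<kappa> (fst p') = Virtual") auto

lemma even_position_adjacent:
  assumes "distinct (u @ [p, p'] @ v)"
  shows "even_position \<kappa> (u @ [p, p'] @ v) p' \<longleftrightarrow>
    (even_position \<kappa> (u @ [p, p'] @ v) p \<longleftrightarrow> \<kappa> (fst p) = Virtual)"
  using assms by auto

text \<open>
  A code with three distinguished segments. As a constant it keeps the simplifier from reassociating
  and splitting the segments.
\<close>

definition code3 where
  "code3 u0 a1 u1 a2 u2 a3 u3 = u0 @ a1 @ u1 @ a2 @ u2 @ a3 @ (u3 :: passage list)"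

lemma even_position_swap3:
  fixes \<kappa> :: "nat \<Rightarrow> crossing_kind"
  assumes "distinct (code3 u0 [p1, p1'] u1 [p2, p2'] u2 [p3, p3'] u3)"
    and "(p, p') \<in> {(p1, p1'), (p2, p2'), (p3, p3')}"
  defines "ep \<equiv> even_position \<kappa> (code3 u0 [p1, p1'] u1 [p2, p2'] u2 [p3, p3'] u3)"
    and "ep' \<equiv> even_position \<kappa> (code3 u0 [p1', p1] u1 [p2', p2] u2 [p3', p3] u3)"
  shows "ep' p \<longleftrightarrow> (ep p \<longleftrightarrow> \<kappa> (fst p') = Virtual)" "ep' p' \<longleftrightarrow> (ep p' \<longleftrightarrow> \<kappa> (fst p) = Virtual)"
    "ep p' \<longleftrightarrow> (ep p \<longleftrightarrow> \<kappa> (fst p) = Virtual)"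
    "r \<notin> {p1, p1', p2, p2', p3, p3'} \<Longrightarrow> ep' r = ep r"
proof -
  let ?w0 = "u0 @ [p1, p1'] @ u1 @ [p2, p2'] @ u2 @ [p3, p3'] @ u3"
  let ?w1 = "u0 @ [p1', p1] @ u1 @ [p2, p2'] @ u2 @ [p3, p3'] @ u3"
  let ?w2 = "u0 @ [p1', p1] @ u1 @ [p2', p2] @ u2 @ [p3, p3'] @ u3"
  let ?w3 = "u0 @ [p1', p1] @ u1 @ [p2', p2] @ u2 @ [p3', p3] @ u3"
  have d0: "distinct ?w0" using assms(1) by (simp add: code3_def)
  have d: "distinct (u0 @ [p1, p1'] @ (u1 @ [p2, p2'] @ u2 @ [p3, p3'] @ u3))"
    "distinct ((u0 @ [p1', p1] @ u1) @ [p2, p2'] @ (u2 @ [p3, p3'] @ u3))"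
    "distinct ((u0 @ [p1', p1] @ u1 @ [p2', p2] @ u2) @ [p3, p3'] @ u3)"
    using d0 by auto
  have neq: "distinct [p1, p1', p2, p2', p3, p3']" using d0 by auto
  note sw = even_position_swap [OF d(1), of \<kappa>, unfolded append_assoc]
    even_position_swap [OF d(2), of \<kappa>, unfolded append_assoc]
    even_position_swap [OF d(3), of \<kappa>, unfolded append_assoc]
  have ep: "ep = even_position \<kappa> ?w0" "ep' = even_position \<kappa> ?w3"
    unfolding ep_def ep'_def code3_def by auto
  have e': "ep' r = 
     (if r = p1 then ep p1 \<longleftrightarrow> \<kappa> (fst p1') = Virtual
      else if r = p1' then ep p1' \<longleftrightarrow> \<kappa> (fst p1) = Virtual
      else if r = p2 then ep p2 \<longleftrightarrow> \<kappa> (fst p2') = Virtual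
      else if r = p2' then ep p2' \<longleftrightarrow> \<kappa> (fst p2) = Virtual
      else if r = p3 then ep p3 \<longleftrightarrow> \<kappa> (fst p3') = Virtual
      else if r = p3' then ep p3' \<longleftrightarrow> \<kappa> (fst p3) = Virtual else ep r)" for r
    using neq unfolding ep sw by simp
  show "ep' p \<longleftrightarrow> (ep p \<longleftrightarrow> \<kappa> (fst p') = Virtual)" "ep' p' \<longleftrightarrow> (ep p' \<longleftrightarrow> \<kappa> (fst p) = Virtual)"
    using assms(2) neq unfolding e' by auto
  show "r \<notin> {p1, p1', p2, p2', p3, p3'} \<Longrightarrow> ep' r = ep r"
    unfolding e' by simp
  have "ep p1' \<longleftrightarrow> (ep p1 \<longleftrightarrow> \<kappa> (fst p1) = Virtual)"
    using even_position_adjacent [of u0 p1 p1' "u1 @ [p2, p2'] @ u2 @ [p3, p3'] @ u3" \<kappa>] d0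
    unfolding ep by simp
  moreover have "ep p2' \<longleftrightarrow> (ep p2 \<longleftrightarrow> \<kappa> (fst p2) = Virtual)"
    using even_position_adjacent [of "u0 @ [p1, p1'] @ u1" p2 p2' "u2 @ [p3, p3'] @ u3" \<kappa>] d0
    unfolding ep append_assoc by blast
  moreover have "ep p3' \<longleftrightarrow> (ep p3 \<longleftrightarrow> \<kappa> (fst p3) = Virtual)"
    using even_position_adjacent [of "u0 @ [p1, p1'] @ u1 @ [p2, p2'] @ u2" p3 p3' u3 \<kappa>] d0
    unfolding ep append_assoc by blast
  ultimately show "ep p' \<longleftrightarrow> (ep p \<longleftrightarrow> \<kappa> (fst p) = Virtual)"
    using assms(2) by auto
qed

section \<open>The third Reidemeister move\<close>

context colouring_units
begin

lemma strand_side_recoloured: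
  assumes "strand inc out a (side b y x) a'"
    and "enter b inc' out' x = enter b inc out y" "leave b inc' out' y = leave b inc out x"
      "leave b inc' out' x = enter b inc' out' y"
  shows "strand inc' out' a (side (\<not> b) y x) a'"
  using assms(1) unfolding strand_side_opposite
  unfolding strand_side using assms(2-4) by (cases b) simp_all

text \<open>
  From the local replacement of colours at a triangle to the whole diagram.
\<close>

lemma colourable_swap3:
  assumes w_def: "w = code3 u0 (side b1 y1 x1) u1 (side b2 y2 x2) u2 (side b3 y3 x3) u3"
    and w'_def: "w' = code3 u0 (side (\<not> b1) y1 x1) u1 (side (\<not> b2) y2 x2) u2 (side (\<not> b3) y3 x3) u3"
    and w: "well_formed w"
    and types: "\<And>c. c \<in> fst ` set w \<Longrightarrow>
      crossing_type (Diagram w' \<kappa>) c = crossing_type (Diagram w \<kappa>) c"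
    and rec: "recolourable (Diagram w \<kappa>) (Diagram w' \<kappa>) {(b1, y1, x1), (b2, y2, x2), (b3, y3, x3)}"
    and same: "{fst y1, fst y2, fst y3} \<subseteq> {fst x1, fst x2, fst x3}"
    and col: "colourable (Diagram w \<kappa>)"
  shows "colourable (Diagram w' \<kappa>)"
proof -
  let ?T = "{(b1, y1, x1), (b2, y2, x2), (b3, y3, x3)}"
  have set_side: "set (side b y x) = {x, y}" for b y x by (auto simp: side_def)
  have set_w: "set w = set u0 \<union> {x1, y1} \<union> set u1 \<union> {x2, y2} \<union> set u2 \<union> {x3, y3} \<union> set u3"
    and set_w': "set w' = set w"
    by (simp_all only: w_def w'_def code3_def set_append set_side Un_assoc)
  from col obtain inc out a where *: "strand inc out a w a"
    "\<And>c. c \<in> fst ` set w \<Longrightarrow> crossing_coloured (Diagram w \<kappa>) inc out c"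
    "\<not> (a = 0 \<and> (\<forall>p \<in> set w. inc p = 0 \<and> out p = 0))"
    by (elim colourableE) (auto simp: crossings_def)
  from *(1) obtain a1 a1' a2 a2' a3 a3' where st: "strand inc out a u0 a1" "strand inc out a1' u1 a2"
    "strand inc out a2' u2 a3" "strand inc out a3' u3 a"
    "strand inc out a1 (side b1 y1 x1) a1'" "strand inc out a2 (side b2 y2 x2) a2'"
    "strand inc out a3 (side b3 y3 x3) a3'"
    unfolding w_def code3_def by (auto simp del: strand.simps)
  have "fst x1 \<in> fst ` set w" "fst x2 \<in> fst ` set w" "fst x3 \<in> fst ` set w"
    using set_w by auto
  then have "\<forall>(b, y, x) \<in> ?T. leave b inc out y = enter b inc out x \<and>
      crossing_coloured (Diagram w \<kappa>) inc out (fst x)"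
    using *(2) st(5-7) by (simp add: strand_side)
  from rec [unfolded recolourable_def, THEN spec, THEN spec, THEN mp, OF this]
  obtain inc' out' where
    away: "\<forall>p. (\<forall>(b, y, x) \<in> ?T. p \<noteq> x \<and> p \<noteq> y) \<longrightarrow> inc' p = inc p \<and> out' p = out p"
    and new: "\<forall>(b, y, x) \<in> ?T. crossing_coloured (Diagram w' \<kappa>) inc' out' (fst x) \<and>
        enter b inc' out' x = enter b inc out y \<and> leave b inc' out' y = leave b inc out x \<and>
        leave b inc' out' x = enter b inc' out' y"
    and zero: "(\<forall>(b, y, x) \<in> ?T. enter b inc out y = 0 \<and> leave b inc out x = 0) \<longrightarrow>
       (\<forall>(b, y, x) \<in> ?T. leave b inc out y = 0)"
    by - (erule exE, erule exE, elim conjE, rule that; assumption)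
  have dist: "distinct (u0 @ side b1 y1 x1 @ u1 @ side b2 y2 x2 @ u2 @ side b3 y3 x3 @ u3)"
    using w unfolding w_def code3_def well_formed_def by simp
  have sides: "set (side b1 y1 x1) = {x1, y1}" "set (side b2 y2 x2) = {x2, y2}"
    "set (side b3 y3 x3) = {x3, y3}" by (simp_all add: set_side)
  have apart: "set u0 \<inter> {x1, y1, x2, y2, x3, y3} = {}" "set u1 \<inter> {x1, y1, x2, y2, x3, y3} = {}"
    "set u2 \<inter> {x1, y1, x2, y2, x3, y3} = {}" "set u3 \<inter> {x1, y1, x2, y2, x3, y3} = {}"
    using dist unfolding distinct_append set_append sides by simp_all
  have outside: "p \<notin> {x1, y1, x2, y2, x3, y3}"
    if "p \<in> set u0 \<or> p \<in> set u1 \<or> p \<in> set u2 \<or> p \<in> set u3" for p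
    proof -
    define X where "X = {x1, y1, x2, y2, x3, y3}"
    have "set u0 \<inter> X = {}" "set u1 \<inter> X = {}" "set u2 \<inter> X = {}" "set u3 \<inter> X = {}"
      unfolding X_def by (fact apart)+
    with that show ?thesis unfolding X_def [symmetric] by blast
  qed
  have same_on: "inc' p = inc p \<and> out' p = out p" if "p \<notin> {x1, y1, x2, y2, x3, y3}" for p
    using that by (intro away [rule_format]) auto
  have seg: "strand inc' out' x u0 y = strand inc out x u0 y"
    "strand inc' out' x u1 y = strand inc out x u1 y" "strand inc' out' x u2 y = strand inc out x u2 y"
    "strand inc' out' x u3 y = strand inc out x u3 y" for x y
    by (intro strand_cong same_on outside; simp)+
  show ?thesis
  proof (rule colourableI [where inc = inc' and out = out' and a = a])
    have "strand inc' out' a1 (side (\<not> b1) y1 x1) a1'" "strand inc' out' a2 (side (\<not> b2) y2 x2) a2'"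
      "strand inc' out' a3 (side (\<not> b3) y3 x3) a3'"
      using strand_side_recoloured [OF st(5)] strand_side_recoloured [OF st(6)]
        strand_side_recoloured [OF st(7)] new by simp_all
    then show "strand inc' out' a (code (Diagram w' \<kappa>)) a"
      using st(1-4) unfolding w'_def code3_def diagram.sel strand_append seg by blast
    show "crossing_coloured (Diagram w' \<kappa>) inc' out' c" if c: "c \<in> crossings (Diagram w' \<kappa>)" for c
    proof (cases "c \<in> {fst x1, fst x2, fst x3}")
      case True
      then show ?thesis using new by auto
    next
      case False
      have c: "c \<in> fst ` set w" using c set_w' by (simp add: crossings_def)
      have "(c, e) \<notin> {x1, y1, x2, y2, x3, y3}" for e
        using False same by force
      then have "crossing_coloured (Diagram w' \<kappa>) inc' out' c = crossing_coloured (Diagram w \<kappa>) inc out c"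
        using same_on by (intro crossing_coloured_cong types c) auto
      then show ?thesis using *(2) [OF c] by simp
    qed
    show False if "a = 0" and zero': "\<forall>p \<in> set (code (Diagram w' \<kappa>)). inc' p = 0 \<and> out' p = 0"
    proof -
      have z: "inc' p = 0 \<and> out' p = 0" if "p \<in> set w" for p using zero' that set_w' by simp
      have T0: "\<forall>(b, y, x) \<in> ?T. enter b inc' out' x = 0 \<and> leave b inc' out' y = 0"
        using z set_w by (auto simp: enter_def leave_def)
      then have T1: "\<forall>(b, y, x) \<in> ?T. enter b inc out y = 0 \<and> leave b inc out x = 0"
        using new by auto
      with zero have T2: "\<forall>(b, y, x) \<in> ?T. leave b inc out y = 0" by blast
      have sides0: "\<forall>p \<in> set (side b y x). inc p = 0 \<and> out p = 0" if "(b, y, x) \<in> ?T" for b y x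
        unfolding all_side using T1 T2 that st(5-7) unfolding strand_side by auto
      then have "inc p = 0 \<and> out p = 0" if "p \<in> {x1, y1, x2, y2, x3, y3}" for p
        using that sides0 [of b1 y1 x1] sides0 [of b2 y2 x2] sides0 [of b3 y3 x3]
        unfolding sides by auto
      then have "inc p = 0 \<and> out p = 0" if "p \<in> set w" for p
        using same_on [of p] z [OF that] by metis
      then show False using * \<open>a = 0\<close> by blast
    qed
  qed
qed

end

text \<open>
  The kinds admitted by the move, in a form in which only the set of crossings and the set of strands
  matter.
\<close>

lemma triangle_kinds:
  assumes "r3_kinds \<kappa> ps" and C: "(\<Union>(p, p') \<in> set ps. {fst p, fst p'}) = C"
  shows "(\<forall>c \<in> C. \<kappa> c = Virtual) \<or>
      (\<exists>c \<in> C. \<forall>c' \<in> C. \<kappa> c' \<noteq> Virtual \<longleftrightarrow> c' = c) \<or>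
      (\<forall>c \<in> C. \<kappa> c \<noteq> Virtual) \<and> (\<exists>(p, p') \<in> set ps. is_over \<kappa> p \<and> is_over \<kappa> p')"
proof -
  have "\<exists>c \<in> C. \<forall>c' \<in> C. \<kappa> c' \<noteq> Virtual \<longleftrightarrow> c' = c" if "card {c \<in> C. \<kappa> c \<noteq> Virtual} = 1"
  proof -
    from that obtain c where c: "{c \<in> C. \<kappa> c \<noteq> Virtual} = {c}" by (rule card_1_singletonE)
    then have "c \<in> C" by blast
    moreover have "\<kappa> c' \<noteq> Virtual \<longleftrightarrow> c' = c" if "c' \<in> C" for c' using c that by blast
    ultimately show ?thesis by blast
  qed
  then show ?thesis using assms(1) unfolding r3_kinds_def C Let_def by blast
qed

text \<open>
  The three given semi-arcs are a whole orbit of the boundary walk, so the walk permutes them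
  cyclically; it may do so against the order in which they occur in the code.
\<close>

lemma face_triangle:
  assumes w: "well_formed w" "w = u0 @ [p1, p1'] @ u1 @ [p2, p2'] @ u2 @ [p3, p3'] @ u3"
    and face: "{(out_arc w p1, b1), (out_arc w p2, b2), (out_arc w p3, b3)} \<in> faces w"
  defines "x1 \<equiv> if b1 then p1' else p1" and "y1 \<equiv> if b1 then p1 else p1'"
    and "x2 \<equiv> if b2 then p2' else p2" and "y2 \<equiv> if b2 then p2 else p2'"
    and "x3 \<equiv> if b3 then p3' else p3" and "y3 \<equiv> if b3 then p3 else p3'"
  shows "meet b1 x1 b2 y2 \<and> meet b2 x2 b3 y3 \<and> meet b3 x3 b1 y1 \<or>
    meet b1 x1 b3 y3 \<and> meet b3 x3 b2 y2 \<and> meet b2 x2 b1 y1"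
proof -
  have d: "distinct w" using w(1) by (simp add: well_formed_def)
  have d6: "distinct [p1, p1', p2, p2', p3, p3']"
    using d [unfolded w(2)] by auto
  have split: "w = u0 @ [p1, p1'] @ (u1 @ [p2, p2'] @ u2 @ [p3, p3'] @ u3)"
    "w = (u0 @ [p1, p1'] @ u1) @ [p2, p2'] @ (u2 @ [p3, p3'] @ u3)"
    "w = (u0 @ [p1, p1'] @ u1 @ [p2, p2'] @ u2) @ [p3, p3'] @ u3"
    using w(2) by simp_all
  let ?d1 = "(out_arc w p1, b1)" and ?d2 = "(out_arc w p2, b2)" and ?d3 = "(out_arc w p3, b3)"
  have pos: "out_arc w p1 = length u0" "out_arc w p2 = length u0 + length u1 + 2"
    "out_arc w p3 = length u0 + length u1 + length u2 + 4"
    using position_eq [OF d, of u0 p1] position_eq [OF d, of "u0 @ [p1, p1'] @ u1" p2]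
      position_eq [OF d, of "u0 @ [p1, p1'] @ u1 @ [p2, p2'] @ u2" p3] w(2)
    by (simp_all add: out_arc_def)
  have d3: "distinct [?d1, ?d2, ?d3]" using pos by simp
  have step:
    "face_step w ?d1 = ?d1 \<Longrightarrow> meet b1 x1 b1 y1" "face_step w ?d1 = ?d2 \<Longrightarrow> meet b1 x1 b2 y2"
    "face_step w ?d1 = ?d3 \<Longrightarrow> meet b1 x1 b3 y3" "face_step w ?d2 = ?d1 \<Longrightarrow> meet b2 x2 b1 y1"
    "face_step w ?d2 = ?d2 \<Longrightarrow> meet b2 x2 b2 y2" "face_step w ?d2 = ?d3 \<Longrightarrow> meet b2 x2 b3 y3"
    "face_step w ?d3 = ?d1 \<Longrightarrow> meet b3 x3 b1 y1" "face_step w ?d3 = ?d2 \<Longrightarrow> meet b3 x3 b2 y2"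
    "face_step w ?d3 = ?d3 \<Longrightarrow> meet b3 x3 b3 y3"
    unfolding x1_def x2_def x3_def y1_def y2_def y3_def
    using face_step_meet [OF w(1) split(1) split(1)] face_step_meet [OF w(1) split(1) split(2)]
      face_step_meet [OF w(1) split(1) split(3)] face_step_meet [OF w(1) split(2) split(1)]
      face_step_meet [OF w(1) split(2) split(2)] face_step_meet [OF w(1) split(2) split(3)]
      face_step_meet [OF w(1) split(3) split(1)] face_step_meet [OF w(1) split(3) split(2)]
      face_step_meet [OF w(1) split(3) split(3)] by blast+
  from face obtain d where orbit: "{?d1, ?d2, ?d3} = {(face_step w ^^ k) d | k. True}"
    unfolding faces_def by blast
  have closed: "face_step w x \<in> {?d1, ?d2, ?d3}" if "x \<in> {?d1, ?d2, ?d3}" for x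
  proof -
    from that obtain k where "x = (face_step w ^^ k) d" unfolding orbit by blast
    then have "face_step w x = (face_step w ^^ Suc k) d" by simp
    then show ?thesis unfolding orbit by blast
  qed
  \<comment> \<open>Both entries of a crossing are determined by one of them.\<close>
  have unique: "x = x'" if "meet b x c y" "meet b' x' c y" for b x c y b' x'
    using that by (cases c; cases b; cases b') (auto simp: meet_def prod_eq_iff)
  have x_neq: "x1 \<noteq> x2" "x2 \<noteq> x3" "x3 \<noteq> x1"
    using d6 by (auto simp: x1_def x2_def x3_def)
  have "face_step w ?d1 \<noteq> face_step w ?d2" "face_step w ?d2 \<noteq> face_step w ?d3"
      "face_step w ?d3 \<noteq> face_step w ?d1"
    using closed [of ?d1] closed [of ?d2] closed [of ?d3] step unique x_neq
    by (metis empty_iff insert_iff)+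
  then have "inj_on (face_step w) {?d1, ?d2, ?d3}"
    by (auto simp: inj_on_def)
  from three_element_orbit [OF orbit d3 this] step show ?thesis by blast
qed

text \<open>
  Exchanging two adjacent passages moves each of them past the other one, which matters for its parity iff the
  other one is classical.
\<close>

lemma even_position_sides:
  fixes \<kappa> :: "nat \<Rightarrow> crossing_kind"
  assumes dist: "distinct (code3 u0 (side b1 y1 x1) u1 (side b2 y2 x2) u2 (side b3 y3 x3) u3)"
    and ep: "ep = even_position \<kappa> (code3 u0 (side b1 y1 x1) u1 (side b2 y2 x2) u2 (side b3 y3 x3) u3)"
    and ep': "ep' = even_position \<kappa>
      (code3 u0 (side (\<not> b1) y1 x1) u1 (side (\<not> b2) y2 x2) u2 (side (\<not> b3) y3 x3) u3)"
  shows "(x, y) \<in> {(x1, y1), (x2, y2), (x3, y3)} \<Longrightarrow>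
      (ep' x \<longleftrightarrow> (ep x \<longleftrightarrow> \<kappa> (fst y) = Virtual)) \<and> (ep' y \<longleftrightarrow> (ep y \<longleftrightarrow> \<kappa> (fst x) = Virtual)) \<and>
      (\<kappa> (fst x) \<noteq> Virtual \<longrightarrow> \<kappa> (fst y) \<noteq> Virtual \<longrightarrow> ep x \<noteq> ep y)"
    and "r \<notin> {x1, y1, x2, y2, x3, y3} \<Longrightarrow> ep' r = ep r"
proof -
  define f g where "f b x y = (if b then y else x)" and "g b x y = (if b then x else y)"
    for b and x y :: passage
  have sides: "side b y x = [f b x y, g b x y]" "side (\<not> b) y x = [g b x y, f b x y]" for b x y
    by (simp_all add: side_def f_def g_def)
  note sw = even_position_swap3 [OF dist [unfolded sides], where \<kappa> = \<kappa>, folded sides, folded ep ep']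
  show "(ep' x \<longleftrightarrow> (ep x \<longleftrightarrow> \<kappa> (fst y) = Virtual)) \<and> (ep' y \<longleftrightarrow> (ep y \<longleftrightarrow> \<kappa> (fst x) = Virtual)) \<and>
      (\<kappa> (fst x) \<noteq> Virtual \<longrightarrow> \<kappa> (fst y) \<noteq> Virtual \<longrightarrow> ep x \<noteq> ep y)"
    if "(x, y) \<in> {(x1, y1), (x2, y2), (x3, y3)}"
  proof -
    let ?P = "{(f b1 x1 y1, g b1 x1 y1), (f b2 x2 y2, g b2 x2 y2), (f b3 x3 y3, g b3 x3 y3)}"
    from that consider "x = x1 \<and> y = y1" | "x = x2 \<and> y = y2" | "x = x3 \<and> y = y3" by auto
    then obtain b where b: "(f b x y, g b x y) \<in> ?P"
    proof cases
      case 1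
      then show ?thesis using that [of b1] by simp
    next
      case 2
      then show ?thesis using that [of b2] by simp
    next
      case 3
      then show ?thesis using that [of b3] by simp
    qed
    show ?thesis
      using sw(1) [OF b] sw(2) [OF b] sw(3) [OF b] by (cases b) (auto simp: f_def g_def)
  qed
  show "ep' r = ep r" if "r \<notin> {x1, y1, x2, y2, x3, y3}"
  proof (rule sw(4))
    show "(f b1 x1 y1, g b1 x1 y1) \<in>
        {(f b1 x1 y1, g b1 x1 y1), (f b2 x2 y2, g b2 x2 y2), (f b3 x3 y3, g b3 x3 y3)}" by simp
    show "r \<notin> {f b1 x1 y1, g b1 x1 y1, f b2 x2 y2, g b2 x2 y2, f b3 x3 y3, g b3 x3 y3}"
      using that by (simp add: f_def g_def)
  qed
qed

context colouring_units
begin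

text \<open>
  A crossing of the triangle keeps its type: its two passages are moved past the two other crossings,
  and these are both classical or both virtual whenever the crossing itself is classical. All
  hypotheses are symmetric under permutations of the strands, apart from the cyclic order.
\<close>

lemma recolourable_triangle:
  assumes w: "well_formed w" "well_formed w'" "set w' = set w" "{x1, y1, x2, y2, x3, y3} \<subseteq> set w"
    and distinct: "distinct [x1, y1, x2, y2, x3, y3]"
    and meet: "meet b1 x1 b2 y2" "meet b2 x2 b3 y3" "meet b3 x3 b1 y1"
    and strands: "\<And>x y. (x, y) \<in> {(x1, y1), (x2, y2), (x3, y3)} \<Longrightarrow>
      (even_position \<kappa> w' x \<longleftrightarrow> (even_position \<kappa> w x \<longleftrightarrow> \<kappa> (fst y) = Virtual)) \<and>
      (even_position \<kappa> w' y \<longleftrightarrow> (even_position \<kappa> w y \<longleftrightarrow> \<kappa> (fst x) = Virtual)) \<and>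
      (\<kappa> (fst x) \<noteq> Virtual \<longrightarrow> \<kappa> (fst y) \<noteq> Virtual \<longrightarrow> even_position \<kappa> w x \<noteq> even_position \<kappa> w y)"
    and others: "\<And>r. r \<notin> {x1, y1, x2, y2, x3, y3} \<Longrightarrow> even_position \<kappa> w' r = even_position \<kappa> w r"
    and kinds: "(\<forall>c \<in> {fst x1, fst x2, fst x3}. \<kappa> c = Virtual) \<or>
      (\<exists>c \<in> {fst x1, fst x2, fst x3}. \<forall>c' \<in> {fst x1, fst x2, fst x3}. \<kappa> c' \<noteq> Virtual \<longleftrightarrow> c' = c) \<or>
      (\<forall>c \<in> {fst x1, fst x2, fst x3}. \<kappa> c \<noteq> Virtual) \<and>
      (\<exists>(x, y) \<in> {(x1, y1), (x2, y2), (x3, y3)}. is_over \<kappa> x \<and> is_over \<kappa> y)"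
  shows "recolourable (Diagram w \<kappa>) (Diagram w' \<kappa>) {(b1, y1, x1), (b2, y2, x2), (b3, y3, x3)}"
    and "c \<in> fst ` set w \<Longrightarrow> crossing_type (Diagram w' \<kappa>) c = crossing_type (Diagram w \<kappa>) c"
proof -
  have fst_y: "fst y2 = fst x1" "fst y3 = fst x2" "fst y1 = fst x3" using meet by (auto simp: meet_def)
  have neq: "fst x1 \<noteq> fst x2" "fst x2 \<noteq> fst x3" "fst x3 \<noteq> fst x1"
  proof -
    have *: "fst z \<noteq> fst x" if "meet b x b' y" "z \<noteq> x" "z \<noteq> y" for b x b' y z
    proof
      assume "fst z = fst x"
      then have "z \<in> {(fst x, From_Left), (fst x, From_Right)}"
        by (cases z; cases "snd z") auto
      then show False using meet_entries [OF that(1)] that(2,3) by blast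
    qed
    show "fst x1 \<noteq> fst x2" "fst x2 \<noteq> fst x3" "fst x3 \<noteq> fst x1"
      using * [OF meet(1), of x2] * [OF meet(2), of x3] * [OF meet(3), of x1] distinct by auto
  qed
  have balanced: "(\<kappa> (fst x2) = Virtual \<longleftrightarrow> \<kappa> (fst x3) = Virtual)" if "\<kappa> (fst x1) \<noteq> Virtual"
    using kinds that neq by (elim disjE) auto
  have balanced2: "(\<kappa> (fst x3) = Virtual \<longleftrightarrow> \<kappa> (fst x1) = Virtual)" if "\<kappa> (fst x2) \<noteq> Virtual"
    using kinds that neq by (elim disjE) auto
  have balanced3: "(\<kappa> (fst x1) = Virtual \<longleftrightarrow> \<kappa> (fst x2) = Virtual)" if "\<kappa> (fst x3) \<noteq> Virtual"
    using kinds that neq by (elim disjE) auto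
  have type: "crossing_type (Diagram w' \<kappa>) c = crossing_type (Diagram w \<kappa>) c"
    if c: "c \<in> fst ` set w" for c
  proof (rule crossing_type_cong)
    have pair: "(ep (c, From_Left) = ep (c, From_Right)) = (ep x = ep y)"
      if "meet b x b' y" "c = fst x" for ep :: "passage \<Rightarrow> bool" and b x b' y
    proof -
      have "x = (c, From_Left) \<and> y = (c, From_Right) \<or> x = (c, From_Right) \<and> y = (c, From_Left)"
        using that by (cases x; cases y) (auto simp: meet_def split: if_splits)
      then show ?thesis by metis
    qed
    note st = strands [of x1 y1] strands [of x2 y2] strands [of x3 y3]
    show "(even_position \<kappa> w' (c, From_Left) = even_position \<kappa> w' (c, From_Right)) =
      (even_position \<kappa> w (c, From_Left) = even_position \<kappa> w (c, From_Right))"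
      if "\<kappa> c \<noteq> Virtual"
    proof -
      consider "c = fst x1" | "c = fst x2" | "c = fst x3" | "c \<notin> {fst x1, fst x2, fst x3}" by blast
      then show ?thesis
      proof cases
        case 1
        then show ?thesis unfolding pair [OF meet(1) 1] using st fst_y balanced that
          by (cases "\<kappa> (fst x3) = Virtual") auto
      next
        case 2
        then show ?thesis unfolding pair [OF meet(2) 2] using st fst_y balanced2 that
          by (cases "\<kappa> (fst x1) = Virtual") auto
      next
        case 3
        then show ?thesis unfolding pair [OF meet(3) 3] using st fst_y balanced3 that
          by (cases "\<kappa> (fst x2) = Virtual") auto
      next
        case 4
        then have "(c, e) \<notin> {x1, y1, x2, y2, x3, y3}" for e using fst_y by force
        then show ?thesis using others by metis
      qed
    qed
  qed (use w c in auto)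
  then show "c \<in> fst ` set w \<Longrightarrow> crossing_type (Diagram w' \<kappa>) c = crossing_type (Diagram w \<kappa>) c" .
  show "recolourable (Diagram w \<kappa>) (Diagram w' \<kappa>) {(b1, y1, x1), (b2, y2, x2), (b3, y3, x3)}"
  proof (rule recolour_triangle [OF meet distinct])
    show "flippable (crossing_type (Diagram w \<kappa>) (fst x1)) (crossing_type (Diagram w \<kappa>) (fst x2))
      (crossing_type (Diagram w \<kappa>) (fst x3)) b1 b2 b3"
      by (rule flippable_triangle [OF w(1) w(4) meet _ neq kinds]) (use strands in blast)
    show "crossing_type (Diagram w' \<kappa>) c = crossing_type (Diagram w \<kappa>) c"
      if "c \<in> {fst x1, fst x2, fst x3}" for c
      using that w(4) by (intro type) auto
  qed
qed

text \<open>
  The two disjuncts for \<open>meet\<close> are the two cyclic orders in which the boundary walk can visit the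
  strands, relative to the code.
\<close>

lemma colourable_R3_step:
  assumes w: "well_formed w" "w = code3 u0 (side b1 y1 x1) u1 (side b2 y2 x2) u2 (side b3 y3 x3) u3"
    and w': "w' = code3 u0 (side (\<not> b1) y1 x1) u1 (side (\<not> b2) y2 x2) u2 (side (\<not> b3) y3 x3) u3"
      "well_formed w'"
    and meet: "meet b1 x1 b2 y2 \<and> meet b2 x2 b3 y3 \<and> meet b3 x3 b1 y1 \<or>
      meet b1 x1 b3 y3 \<and> meet b3 x3 b2 y2 \<and> meet b2 x2 b1 y1"
    and kinds: "(\<forall>c \<in> {fst x1, fst x2, fst x3}. \<kappa> c = Virtual) \<or>
      (\<exists>c \<in> {fst x1, fst x2, fst x3}. \<forall>c' \<in> {fst x1, fst x2, fst x3}. \<kappa> c' \<noteq> Virtual \<longleftrightarrow> c' = c) \<or>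
      (\<forall>c \<in> {fst x1, fst x2, fst x3}. \<kappa> c \<noteq> Virtual) \<and>
      (\<exists>(x, y) \<in> {(x1, y1), (x2, y2), (x3, y3)}. is_over \<kappa> x \<and> is_over \<kappa> y)"
    and col: "colourable (Diagram w \<kappa>)"
  shows "colourable (Diagram w' \<kappa>)"
proof -
  let ?X = "{x1, y1, x2, y2, x3, y3}"
  have set_side: "set (side b y x) = {x, y}" for b y x by (auto simp: side_def)
  have set_w: "set w' = set w"
    by (simp only: w(2) w'(1) code3_def set_append set_side)
  have X_w: "?X \<subseteq> set w"
    unfolding w(2) code3_def set_append set_side by simp
  have d: "distinct w" using w(1) by (simp add: well_formed_def)
  have "distinct (side b y x) \<longleftrightarrow> x \<noteq> y" for b and x y :: passage
    by (cases b) (auto simp: side_def)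
  note distinct_side = this
  have d6: "distinct [x1, y1, x2, y2, x3, y3]"
    using d [unfolded w(2) code3_def] by (auto simp: set_side distinct_side)
  note ep = even_position_sides [OF d [unfolded w(2)] refl refl, where \<kappa> = \<kappa>, folded w(2) w'(1)]
  have perm: "{x1, y1, x3, y3, x2, y2} = ?X" "{(x1, y1), (x3, y3), (x2, y2)} = {(x1, y1), (x2, y2), (x3, y3)}"
    "{(b1, y1, x1), (b3, y3, x3), (b2, y2, x2)} = {(b1, y1, x1), (b2, y2, x2), (b3, y3, x3)}"
    "{fst x1, fst x3, fst x2} = {fst x1, fst x2, fst x3}" by blast+
  have *: "recolourable (Diagram w \<kappa>) (Diagram w' \<kappa>) {(b1, y1, x1), (b2, y2, x2), (b3, y3, x3)} \<and>
     (\<forall>c \<in> fst ` set w. crossing_type (Diagram w' \<kappa>) c = crossing_type (Diagram w \<kappa>) c)"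
    using meet
  proof (elim disjE conjE)
    assume m: "meet b1 x1 b2 y2" "meet b2 x2 b3 y3" "meet b3 x3 b1 y1"
    note rt = recolourable_triangle [OF w(1) w'(2) set_w X_w d6 m ep(1) ep(2) kinds]
    show ?thesis using rt by blast
  next
    assume m: "meet b1 x1 b3 y3" "meet b3 x3 b2 y2" "meet b2 x2 b1 y1"
    have d6': "distinct [x1, y1, x3, y3, x2, y2]" using d6 by auto
    note rt = recolourable_triangle [OF w(1) w'(2) set_w _ d6' m, where \<kappa> = \<kappa>, unfolded perm,
      OF X_w ep(1) ep(2) kinds]
    show ?thesis using rt by blast
  qed
  show ?thesis
  proof (rule colourable_swap3 [OF w(2) w'(1) w(1) _ _ _ col])
    show "{fst y1, fst y2, fst y3} \<subseteq> {fst x1, fst x2, fst x3}"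
      using meet by (auto simp: meet_def)
  qed (use * in blast)+
qed

text \<open>
  The flipped triangle satisfies the same hypotheses with all directions \<open>b\<close> negated: the face is now on
  the other side of its strands and its boundary is followed the opposite way. So one implication gives both.
\<close>

lemma colourable_R3:
  assumes w: "well_formed w" "w = u0 @ [p1, p1'] @ u1 @ [p2, p2'] @ u2 @ [p3, p3'] @ u3"
    and w': "well_formed w'" "w' = u0 @ [p1', p1] @ u1 @ [p2', p2] @ u2 @ [p3', p3] @ u3"
    and face: "{(out_arc w p1, b1), (out_arc w p2, b2), (out_arc w p3, b3)} \<in> faces w"
    and kinds: "r3_kinds \<kappa> [(p1, p1'), (p2, p2'), (p3, p3')]"
  shows "colourable (Diagram w \<kappa>) \<longleftrightarrow> colourable (Diagram w' \<kappa>)"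
proof -
  define x1 y1 x2 y2 x3 y3 where defs: "x1 = (if b1 then p1' else p1)" "y1 = (if b1 then p1 else p1')"
    "x2 = (if b2 then p2' else p2)" "y2 = (if b2 then p2 else p2')"
    "x3 = (if b3 then p3' else p3)" "y3 = (if b3 then p3 else p3')"
  have meet: "meet b1 x1 b2 y2 \<and> meet b2 x2 b3 y3 \<and> meet b3 x3 b1 y1 \<or>
    meet b1 x1 b3 y3 \<and> meet b3 x3 b2 y2 \<and> meet b2 x2 b1 y1"
    using face_triangle [OF w face] unfolding defs .
  have W: "w = code3 u0 (side b1 y1 x1) u1 (side b2 y2 x2) u2 (side b3 y3 x3) u3"
    "w' = code3 u0 (side (\<not> b1) y1 x1) u1 (side (\<not> b2) y2 x2) u2 (side (\<not> b3) y3 x3) u3"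
    by (simp_all add: w(2) w'(2) code3_def side_def defs)
  have "(\<Union>(p, p') \<in> set [(p1, p1'), (p2, p2'), (p3, p3')]. {fst p, fst p'}) =
      {fst x1, fst x2, fst x3} \<union> {fst y1, fst y2, fst y3}"
    by (auto simp: defs)
  also have "\<dots> = {fst x1, fst x2, fst x3}" using meet by (auto simp: meet_def)
  finally have C: "(\<Union>(p, p') \<in> set [(p1, p1'), (p2, p2'), (p3, p3')]. {fst p, fst p'}) =
      {fst x1, fst x2, fst x3}" .
  have over: "(\<exists>(p, p') \<in> set [(p1, p1'), (p2, p2'), (p3, p3')]. is_over \<kappa> p \<and> is_over \<kappa> p') \<longleftrightarrow>
      (\<exists>(x, y) \<in> {(x1, y1), (x2, y2), (x3, y3)}. is_over \<kappa> x \<and> is_over \<kappa> y)"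
    by (auto simp: defs)
  note kinds' = triangle_kinds [OF kinds C, unfolded over]
  have W': "w = code3 u0 (side (\<not> \<not> b1) y1 x1) u1 (side (\<not> \<not> b2) y2 x2) u2 (side (\<not> \<not> b3) y3 x3) u3"
    using W(1) by simp
  have "colourable (Diagram w \<kappa>) \<Longrightarrow> colourable (Diagram w' \<kappa>)"
    by (rule colourable_R3_step [OF w(1) W(1) W(2) w'(1) meet kinds'])
  moreover have "colourable (Diagram w' \<kappa>) \<Longrightarrow> colourable (Diagram w \<kappa>)"
    by (rule colourable_R3_step [OF w'(1) W(2) W' w(1) _ kinds']) (use meet in \<open>simp add: meet_opposite\<close>)
  ultimately show ?thesis by blast
qed

lemma colourable_move:
  assumes "move D D'" "well_formed (code D)" "well_formed (code D')"
  shows "colourable D \<longleftrightarrow> colourable D'"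
  using assms
proof (cases rule: move.cases)
  case (relabel f w \<kappa>' \<kappa> m)
  have "well_formed (rotate m w)" using assms(2) relabel well_formed_rotate by simp
  then have "colourable (Diagram (map (\<lambda>(c, e). (f c, e)) (rotate m w)) \<kappa>') \<longleftrightarrow>
      colourable (Diagram (rotate m w) \<kappa>)"
    using relabel assms(3) by (intro colourable_rename) simp_all
  then show ?thesis
    using colourable_rotate [of w m \<kappa>] relabel assms(2) by simp
next
  case (R1 u c e v \<kappa>)
  then show ?thesis using colourable_R1 [of u c e v \<kappa>] assms by simp
next
  case (R2_parallel \<kappa> c e d u v w)
  then show ?thesis
    using colourable_R2 [of u c e d v "(c, opp e)" "(d, e)" w \<kappa>] assms by simp
next
  case (R2_antiparallel \<kappa> c e d u v w)
  then show ?thesis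
    using colourable_R2 [of u c e d v "(d, e)" "(c, opp e)" w \<kappa>] assms by simp
next
  case (R3 w u0 p1 p1' u1 p2 p2' u2 p3 p3' u3 b1 b2 b3 \<kappa>)
  then show ?thesis using colourable_R3 [OF _ R3(3) _ refl R3(4) R3(5)] assms by simp
qed

lemma colourable_equivalent:
  assumes "equivalent D D'"
  shows "colourable D \<longleftrightarrow> colourable D'"
  using assms unfolding equivalent_def
proof (induction rule: equivclp_induct)
  case (step y z)
  then show ?case using colourable_move unfolding knot_diagram_def by blast
qed simp

lemma colourable_unknot: "colourable unknot"
  by (rule colourableI [where a = 1]) (simp_all add: unknot_def crossings_def)

end

section \<open>Kernel vectors and first minors\<close>

text \<open>
  The lexicographic order is compatible with addition. So the exponent vectors form a linearly
  ordered group, by which the Laurent polynomials are recognised as an integral domain.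
\<close>

instance prod :: (linordered_ab_group_add, linordered_ab_group_add) linordered_ab_group_add
  by standard (auto simp: less_eq_prod_def)

text \<open>
  Two independent kernel vectors have a nonzero combination \<open>w\<close> whose \<open>j\<close>-th entry is zero. Without this entry
  it is in the kernel of every matrix that arises by deleting column \<open>j\<close> and some row.
\<close>

lemma first_minors_eq_zero:
  fixes A :: "'a :: idom mat"
  assumes A: "A \<in> carrier_mat n n" and u: "\<And>i. i < n \<Longrightarrow> (\<Sum>k<n. A $$ (i, k) * u k) = 0"
    and v: "\<And>i. i < n \<Longrightarrow> (\<Sum>k<n. A $$ (i, k) * v k) = 0"
    and indep: "l < n" "u l \<noteq> 0" "v l = 0" "m < n" "v m \<noteq> 0"
  shows "first_minors A \<subseteq> {0}"
proof -
  have "det (mat_delete A i j) = 0" if ij: "i < n" "j < n" for i j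
  proof -
    define w where "w k = (if v j = 0 then v k else u j * v k - v j * u k)" for k
    have wj: "w j = 0" by (simp add: w_def)
    obtain p where p: "p < n" "w p \<noteq> 0"
      using indep by (cases "v j = 0") (auto simp: w_def)
    have "p \<noteq> j" using wj p by auto
    have ker: "(\<Sum>k<n. A $$ (r, k) * w k) = 0" if "r < n" for r
    proof (cases "v j = 0")
      case True
      then show ?thesis using v [OF that] by (simp add: w_def)
    next
      case False
      have "(\<Sum>k<n. A $$ (r, k) * w k) =
          u j * (\<Sum>k<n. A $$ (r, k) * v k) - v j * (\<Sum>k<n. A $$ (r, k) * u k)"
        using False by (simp add: w_def sum_distrib_left sum_subtractf algebra_simps)
      then show ?thesis using u [OF that] v [OF that] by simp
    qed
    define gap where "gap i k = (if k < i then k else Suc k)" for i k :: nat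
    define w' where "w' = vec (n - 1) (\<lambda>k. w (gap j k))"
    have carrier: "mat_delete A i j \<in> carrier_mat (n - 1) (n - 1)"
      using A by (rule mat_delete_carrier)
    have "mat_delete A i j *\<^sub>v w' = 0\<^sub>v (n - 1)"
    proof (rule eq_vecI)
      fix r assume "r < dim_vec (0\<^sub>v (n - 1) :: 'a vec)"
      then have r: "r < n - 1" by simp
      then have r': "gap i r < n" using ij by (auto simp: gap_def)
      have "(mat_delete A i j *\<^sub>v w') $ r = (\<Sum>k<n - 1. A $$ (gap i r, gap j k) * w (gap j k))"
        using A r by (simp add: mat_delete_def w'_def scalar_prod_def gap_def atLeast0LessThan)
      also have "\<dots> = (\<Sum>k\<in>{..<n} - {j}. A $$ (gap i r, k) * w k)"
        by (rule sum.reindex_bij_witness [where j = "gap j" and i = "\<lambda>k. if k < j then k else k - 1"])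
          (use ij in \<open>auto simp: gap_def\<close>)
      also have "\<dots> = (\<Sum>k<n. A $$ (gap i r, k) * w k)"
        using ij wj by (intro sum.mono_neutral_left) auto
      finally show "(mat_delete A i j *\<^sub>v w') $ r = 0\<^sub>v (n - 1) $ r"
        using ker [OF r'] r by simp
    qed (use A in simp)
    moreover have "w' \<noteq> 0\<^sub>v (n - 1)"
    proof
      assume w'0: "w' = 0\<^sub>v (n - 1)"
      define p' where "p' = (if p < j then p else p - 1)"
      have p': "p' < n - 1" "gap j p' = p" using p(1) \<open>p \<noteq> j\<close> ij by (auto simp: p'_def gap_def)
      have "w' $ p' = w p" using p' by (simp add: w'_def)
      then show False using w'0 p' p(2) by simp
    qed
    moreover have "w' \<in> carrier_vec (n - 1)" by (simp add: w'_def)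
    ultimately show ?thesis using det_0_iff_vec_prod_zero [OF carrier] by blast
  qed
  then show ?thesis using A by (auto simp: first_minors_def)
qed

lemma PhiDelta_eq_zero:
  assumes "first_minors (alexander_matrix D) \<subseteq> {0}"
  shows "PhiDelta D = 0"
proof -
  let ?X = "first_minors (alexander_matrix D)"
  have X: "x = 0" if "x \<in> ?X" for x using that assms by blast
  have "is_gcd ?X 0"
    unfolding is_gcd_def by (intro conjI ballI allI impI) (simp_all add: X)
  then have "is_gcd ?X (SOME d. is_gcd ?X d)" by (rule someI)
  moreover have "d = 0" if "is_gcd ?X d" for d
  proof -
    have "\<forall>x \<in> ?X. 0 dvd x" by (simp add: X)
    then have "0 dvd d" using that unfolding is_gcd_def by blast
    then show ?thesis by simp
  qed
  ultimately show ?thesis by (simp add: PhiDelta_def)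
qed

section \<open>Fox derivatives\<close>

definition letter_value :: "generator \<times> bool \<Rightarrow> laurent" where
  "letter_value l = Poly_Mapping.single (if snd l then exponent (fst l) else - exponent (fst l)) 1"

lemma letter_value_cancel [simp]:
  "letter_value (g, True) * letter_value (g, False) = 1"
  "letter_value (g, False) * letter_value (g, True) = 1"
  by (simp_all add: letter_value_def mult_single)

lemma eval_word_simps [simp]:
  "eval_word [] = 1" "eval_word (l # u) = letter_value l * eval_word u"
  "eval_word (u @ v) = eval_word u * eval_word v"
  by (simp_all add: eval_word_def letter_value_def case_prod_beta)

lemma eval_fsum_fox_Cons:
  "eval_fsum (fox x (l # u)) =
    (if fst l = x then if snd l then 1 else - letter_value l else 0) +
    letter_value l * eval_fsum (fox x u)"
proof -
  have "eval_fsum (map (\<lambda>(k, v). (k, l # v)) a) = letter_value l * eval_fsum a" for a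
    by (induction a) (auto simp: eval_fsum_def algebra_simps)
  moreover have "eval_fsum (a @ b) = eval_fsum a + eval_fsum b" for a b
    by (simp add: eval_fsum_def)
  ultimately show ?thesis
    by (cases l) (auto simp: eval_fsum_def)
qed

text \<open>
  The value on a word of the derivation that extends given values \<open>\<delta>\<close> on the generators. It is computed
  along the word, so that it can be evaluated on the relators by simplification.
\<close>

fun derivation :: "(generator \<Rightarrow> laurent) \<Rightarrow> generator fword \<Rightarrow> laurent" where
  "derivation \<delta> [] = 0"
| "derivation \<delta> (l # u) =
     (if snd l then \<delta> (fst l) else - letter_value l * \<delta> (fst l)) + letter_value l * derivation \<delta> u"

lemma derivation_append [simp]:
  "derivation \<delta> (u @ v) = derivation \<delta> u + eval_word u * derivation \<delta> v"
  by (induction u) (auto simp: algebra_simps)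

text \<open>
  The Fox derivatives are the matrix entries of \<open>derivation\<close>: the chain rule
  \<open>D u = (\<Sum>g. \<partial>u/\<partial>g * D g)\<close>.
\<close>

lemma derivation_eq_sum_fox:
  assumes "distinct gs" "fst ` set u \<subseteq> set gs"
  shows "(\<Sum>j<length gs. eval_fsum (fox (gs ! j) u) * \<delta> (gs ! j)) = derivation \<delta> u"
  using assms(2)
proof (induction u)
  case Nil
  then show ?case by (simp add: eval_fsum_def)
next
  case (Cons l u)
  let ?c = "if snd l then 1 else - letter_value l"
  from Cons.prems obtain i where i: "i < length gs" "gs ! i = fst l"
    by (auto simp: in_set_conv_nth)
  have "(\<Sum>j<length gs. eval_fsum (fox (gs ! j) (l # u)) * \<delta> (gs ! j)) =
    (\<Sum>j<length gs. (if j = i then ?c * \<delta> (fst l) else 0) +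
       letter_value l * (eval_fsum (fox (gs ! j) u) * \<delta> (gs ! j)))"
  proof (rule sum.cong [OF refl])
    fix j assume "j \<in> {..<length gs}"
    then have "fst l = gs ! j \<longleftrightarrow> j = i"
      using i assms(1) by (auto simp: nth_eq_iff_index_eq)
    then show "eval_fsum (fox (gs ! j) (l # u)) * \<delta> (gs ! j) =
      (if j = i then ?c * \<delta> (fst l) else 0) + letter_value l * (eval_fsum (fox (gs ! j) u) * \<delta> (gs ! j))"
      using i by (auto simp: eval_fsum_fox_Cons algebra_simps)
  qed
  also have "\<dots> = ?c * \<delta> (fst l) + letter_value l * derivation \<delta> u"
    using i Cons by (simp add: sum.distrib sum_distrib_left [symmetric])
  finally show ?case by simp
qed

text \<open>
  The fundamental formula of Fox: the derivation \<open>u \<mapsto> u - 1\<close> is determined by its values on the generators.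
\<close>

lemma derivation_fundamental:
  "derivation (\<lambda>g. letter_value (g, True) - 1) u = eval_word u - 1"
proof (induction u)
  case (Cons l u)
  show ?case
  proof (cases l)
    case (Pair g b)
    then show ?thesis by (cases b) (simp_all add: Cons.IH right_diff_distrib)
  qed
qed simp

definition "var_s = (Poly_Mapping.single (1, 0, 0, 0) 1 :: laurent)"
definition "var_s' = (Poly_Mapping.single (-1, 0, 0, 0) 1 :: laurent)"
definition "var_t = (Poly_Mapping.single (0, 1, 0, 0) 1 :: laurent)"
definition "var_t' = (Poly_Mapping.single (0, -1, 0, 0) 1 :: laurent)"
definition "var_q = (Poly_Mapping.single (0, 0, 1, 0) 1 :: laurent)"
definition "var_q' = (Poly_Mapping.single (0, 0, -1, 0) 1 :: laurent)"
definition "var_theta = (Poly_Mapping.single (0, 0, 0, 1) 1 :: laurent)"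
definition "var_theta' = (Poly_Mapping.single (0, 0, 0, -1) 1 :: laurent)"
lemmas var_defs = var_s_def var_s'_def var_t_def var_t'_def var_q_def var_q'_def
  var_theta_def var_theta'_def

interpretation laurent: colouring_units var_s var_s' var_t var_t' var_q var_q' var_theta var_theta'
  by unfold_locales (simp_all add: var_defs mult_single flip: zero_prod_def)

lemma letter_value_simps [simp]:
  "letter_value (Arc i, True) = var_t" "letter_value (Arc i, False) = var_t'"
  "letter_value (Gen_s, True) = var_s" "letter_value (Gen_s, False) = var_s'"
  "letter_value (Gen_q, True) = var_q" "letter_value (Gen_q, False) = var_q'"
  "letter_value (Gen_theta, True) = var_theta" "letter_value (Gen_theta, False) = var_theta'"
  by (simp_all add: letter_value_def var_defs)

text \<open>
  The relators depend on the crossing only through its type and the adjacent semi-arcs.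
\<close>

lemma crossing_relators_eq:
  "crossing_relators D c =
    (let X = Arc (in_arc (code D) (c, From_Left)); Y = Arc (in_arc (code D) (c, From_Right));
         Z = Arc (out_arc (code D) (c, From_Right)); W = Arc (out_arc (code D) (c, From_Left))
     in case crossing_type D c of
       Virtual_Type \<Rightarrow>
         [[(Gen_q, False), (Y, True), (Gen_q, True), (Z, False)],
          [(Gen_q, True), (X, True), (Gen_q, False), (W, False)]]
     | Odd_Type \<Rightarrow>
         [[(Gen_theta, False), (Y, True), (Gen_theta, True), (Z, False)],
          [(Gen_theta, True), (X, True), (Gen_theta, False), (W, False)]]
     | Even_Positive \<Rightarrow>
         [[(X, True), (Y, True), (Gen_s, True), (X, False), (Gen_s, False), (Z, False)],
          [(Gen_s, True), (X, True), (Gen_s, False), (W, False)]]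
     | Even_Negative \<Rightarrow>
         [[(Gen_s, False), (Y, True), (Gen_s, True), (Z, False)],
          [(Gen_s, False), (Y, False), (Gen_s, True), (X, True), (Y, True), (W, False)]])"
  by (simp add: crossing_relators_def crossing_type_def gen_def inv_word_def Let_def)

lemma relators_cases:
  assumes "r \<in> set (relators D)"
  obtains c where "c \<in> fst ` set (code D)" "r \<in> set (crossing_relators D c)"
  | g h where "r = [(g, True), (h, True), (g, False), (h, False)]" "g \<in> {Gen_s, Gen_theta}"
      "h \<in> {Gen_q, Gen_theta}"
  using assms by (fastforce simp: relators_def commutator_word_def gen_def inv_word_def)

lemma eval_word_relators:
  assumes "r \<in> set (relators D)"
  shows "eval_word r = 1"
  using assms
proof (cases rule: relators_cases)
  case (1 c)
  then show ?thesis
    unfolding crossing_relators_eq Let_def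
    by (cases "crossing_type D c") (auto simp: ac_simps)
next
  case (2 g h)
  then show ?thesis by (auto simp: ac_simps)
qed

lemma relator_generators:
  assumes w: "well_formed (code D)" and r: "r \<in> set (relators D)"
  shows "fst ` set r \<subseteq> set (generators D)"
proof -
  have arc: "out_arc (code D) (c, e) < length (code D)" "in_arc (code D) (c, e) < length (code D)"
    if "c \<in> fst ` set (code D)" for c e
  proof -
    have "(c, e) \<in> set (code D)" using well_formed_passage [OF w that] .
    then show "out_arc (code D) (c, e) < length (code D)"
      unfolding out_arc_def by (rule nth_position)
    show "in_arc (code D) (c, e) < length (code D)"
      using \<open>(c, e) \<in> set (code D)\<close> unfolding in_arc_def by (intro mod_less_divisor) (cases "code D"; simp)
  qed
  have gens: "set (generators D) = Arc ` {..<length (code D)} \<union> {Gen_s, Gen_q, Gen_theta}"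
    by (auto simp: generators_def)
  from r show ?thesis
  proof (cases rule: relators_cases)
    case (1 c)
    note arc' = arc [OF 1(1), of From_Left] arc [OF 1(1), of From_Right]
    show ?thesis
      using 1(2) arc' unfolding gens crossing_relators_eq Let_def
      by (cases "crossing_type D c") auto
  next
    case 2
    then show ?thesis unfolding gens by auto
  qed
qed

text \<open>
  The rows of the Alexander matrix are thus exactly the relators, two for each crossing and three commutators.
\<close>

lemma length_relators:
  assumes "well_formed (code D)"
  shows "length (relators D) = length (code D) + 3"
proof -
  let ?C = "fst ` set (code D)"
  have "set (code D) = ?C \<times> {From_Left, From_Right}"
  proof (intro equalityI subsetI)
    fix p :: passage
    assume "p \<in> set (code D)"
    moreover have "snd p = From_Left \<or> snd p = From_Right" by (cases "snd p") auto
    ultimately show "p \<in> ?C \<times> {From_Left, From_Right}" by (auto simp: mem_Times_iff)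
  next
    fix p :: passage
    assume "p \<in> ?C \<times> {From_Left, From_Right}"
    then have "fst p \<in> ?C" by (auto simp: mem_Times_iff)
    from well_formed_passage [OF assms this, of "snd p"] show "p \<in> set (code D)" by simp
  qed
  from arg_cong [OF this, of card] have "card (set (code D)) = card ?C * 2"
    unfolding card_cartesian_product by simp
  moreover have "card (set (code D)) = length (code D)"
    using assms by (simp add: well_formed_def distinct_card)
  moreover have "length (concat (map (crossing_relators D) cs)) = 2 * length cs" for cs
    by (induction cs) (auto simp: crossing_relators_eq Let_def split: crossing_type.split)
  ultimately show ?thesis
    by (simp add: relators_def length_remdups_card_conv)
qed

lemma strand_nth:
  assumes "strand inc out a w b" "i < length w"
  shows "inc (w ! i) = (if i = 0 then a else out (w ! (i - 1)))"
  using assms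
proof (induction w arbitrary: a i)
  case (Cons p w)
  then show ?case by (cases i) (auto simp: nth_Cons')
qed simp

lemma strand_last:
  assumes "strand inc out a w b" "w \<noteq> []"
  shows "b = out (w ! (length w - 1))"
  using assms
proof (induction w arbitrary: a)
  case (Cons p w)
  then show ?case by (cases w) auto
qed simp

lemma strand_in_arc:
  assumes "strand inc out a w a" "p \<in> set w"
  shows "out (w ! in_arc w p) = inc p"
proof -
  have pos: "w ! position w p = p" "position w p < length w" using nth_position [OF assms(2)] by auto
  have "w \<noteq> []" using assms(2) by auto
  show ?thesis
  proof (cases "position w p")
    case 0
    then have "in_arc w p = length w - 1" using pos(2) by (simp add: in_arc_def)
    then show ?thesis
      using strand_nth [OF assms(1) pos(2)] strand_last [OF assms(1) \<open>w \<noteq> []\<close>] 0 pos(1) by simp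
  next
    case (Suc i)
    then have "in_arc w p = i" using pos(2) by (simp add: in_arc_def)
    then show ?thesis using strand_nth [OF assms(1) pos(2)] Suc pos(1) by simp
  qed
qed

text \<open>
  The colouring, extended by zero to \<open>s\<close>, \<open>q\<close> and \<open>\<theta>\<close>, and the vector \<open>g - 1\<close> are independent kernel vectors
  of the Alexander matrix.
\<close>

lemma PhiDelta_colourable:
  assumes w: "well_formed (code D)" and col: "laurent.colourable D"
  shows "PhiDelta D = 0"
proof (cases "code D = []")
  case True
  then show ?thesis by (simp add: PhiDelta_def)
next
  case False
  let ?w = "code D" and ?n = "length (code D) + 3"
  from col obtain inc out a where st: "strand inc out a ?w a"
    and cr: "\<And>c. c \<in> crossings D \<Longrightarrow> laurent.crossing_coloured D inc out c"
    and nontrivial: "\<not> (a = 0 \<and> (\<forall>p \<in> set ?w. inc p = 0 \<and> out p = 0))"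
    by (elim laurent.colourableE) auto
  define \<delta> where "\<delta> g = (case g of Arc i \<Rightarrow> out (?w ! i) | _ \<Rightarrow> 0)" for g
  define \<gamma> where "\<gamma> g = letter_value (g, True) - 1" for g
  have \<delta>: "\<delta> (Arc i) = out (?w ! i)" "\<delta> Gen_s = 0" "\<delta> Gen_q = 0" "\<delta> Gen_theta = 0" for i
    by (simp_all add: \<delta>_def)
  have relator: "derivation \<delta> r = 0" if "r \<in> set (relators D)" for r
  proof -
    from that show ?thesis
    proof (cases rule: relators_cases)
      case (1 c)
      have mem: "(c, e) \<in> set ?w" for e using well_formed_passage [OF w 1(1)] .
      have arcs: "out (?w ! in_arc ?w (c, e)) = inc (c, e)" "out (?w ! out_arc ?w (c, e)) = out (c, e)" for e
        using strand_in_arc [OF st mem] nth_position [OF mem] by (simp_all add: out_arc_def)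
      have "laurent.crossing_rel (crossing_type D c) (inc (c, From_Left)) (inc (c, From_Right))
          (out (c, From_Right)) (out (c, From_Left))"
        using cr [of c] 1(1) by (simp add: crossings_def laurent.crossing_coloured_def)
      then show ?thesis
        using 1(2) unfolding crossing_relators_eq Let_def
        by (cases "crossing_type D c") (auto simp: \<delta> arcs algebra_simps)
    next
      case (2 g h)
      then show ?thesis by (auto simp: \<delta>)
    qed
  qed
  have distinct: "distinct (generators D)"
    by (auto simp: generators_def distinct_map inj_on_def)
  have len: "length (generators D) = ?n" by (simp add: generators_def)
  have kernel: "(\<Sum>k<?n. alexander_matrix D $$ (i, k) * \<epsilon> (generators D ! k)) = 0"
    if i: "i < ?n" and zero: "\<And>r. r \<in> set (relators D) \<Longrightarrow> derivation \<epsilon> r = 0" for i \<epsilon>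
  proof -
    have r: "relators D ! i \<in> set (relators D)" using i length_relators [OF w] by simp
    have "(\<Sum>k<?n. alexander_matrix D $$ (i, k) * \<epsilon> (generators D ! k)) =
      (\<Sum>k<?n. eval_fsum (fox (generators D ! k) (relators D ! i)) * \<epsilon> (generators D ! k))"
      using i by (intro sum.cong refl) (simp add: alexander_matrix_def)
    also have "\<dots> = derivation \<epsilon> (relators D ! i)"
      using derivation_eq_sum_fox [OF distinct relator_generators [OF w r], of \<epsilon>] len by simp
    finally show ?thesis using zero [OF r] by simp
  qed
  have "\<exists>m<length ?w. out (?w ! m) \<noteq> 0"
  proof (rule ccontr)
    assume "\<not> ?thesis"
    then have z: "out (?w ! m) = 0" if "m < length ?w" for m using that by blast
    then have o0: "out p = 0" if "p \<in> set ?w" for p using that by (metis in_set_conv_nth)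
    have "a = 0" using strand_last [OF st False] z [of "length ?w - 1"] False by simp
    moreover have "inc p = 0" if "p \<in> set ?w" for p
      using strand_nth [OF st] z \<open>a = 0\<close> that by (metis in_set_conv_nth less_imp_diff_less)
    ultimately show False using nontrivial o0 by blast
  qed
  then obtain m where m: "m < length ?w" "out (?w ! m) \<noteq> 0" by blast
  have gen_m: "generators D ! m = Arc m" and gen_s: "generators D ! length ?w = Gen_s"
    using m by (simp_all add: generators_def nth_append)
  have "first_minors (alexander_matrix D) \<subseteq> {0}"
  proof (rule first_minors_eq_zero [where n = ?n and u = "\<lambda>k. \<gamma> (generators D ! k)"
        and v = "\<lambda>k. \<delta> (generators D ! k)" and l = "length ?w" and m = m])
    show "alexander_matrix D \<in> carrier_mat ?n ?n" by (simp add: alexander_matrix_def)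
    show "(\<Sum>k<?n. alexander_matrix D $$ (i, k) * \<gamma> (generators D ! k)) = 0" if "i < ?n" for i
      using that by (rule kernel) (simp add: \<gamma>_def derivation_fundamental eval_word_relators)
    show "(\<Sum>k<?n. alexander_matrix D $$ (i, k) * \<delta> (generators D ! k)) = 0" if "i < ?n" for i
      using that by (rule kernel) (rule relator)
    have "Poly_Mapping.lookup var_s 0 \<noteq> Poly_Mapping.lookup 1 0"
      by (simp add: var_s_def lookup_single lookup_one zero_prod_def)
    then show "\<gamma> (generators D ! length ?w) \<noteq> 0"
      unfolding gen_s \<gamma>_def by auto
  qed (use m gen_m gen_s \<delta> in auto)
  then show ?thesis by (rule PhiDelta_eq_zero)
qed

section \<open>Switching odd crossings\<close>

lemma PhiDelta_switch_odd:
  assumes "S \<subseteq> odd_crossings K"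
  shows "PhiDelta (switch_crossings S K) = PhiDelta K"
proof -
  let ?K' = "switch_crossings S K"
  have code: "code ?K' = code K" by (simp add: switch_crossings_def)
  have virt: "kind ?K' c = Virtual \<longleftrightarrow> kind K c = Virtual" for c
    by (cases "kind K c") (simp_all add: switch_crossings_def)
  have "classical_word ?K' = classical_word K"
    by (simp add: classical_word_def code virt)
  then have odd: "odd_crossings ?K' = odd_crossings K"
    by (simp add: odd_crossings_def crossings_def code virt)
  have "crossing_type ?K' c = crossing_type K c" for c
  proof (cases "c \<in> S")
    case True
    then have "c \<in> odd_crossings K" using assms by blast
    then show ?thesis using odd virt [of c] by (simp add: crossing_type_def odd_crossings_def)
  next
    case False
    then show ?thesis using odd by (simp add: crossing_type_def switch_crossings_def)
  qed
  then have "crossing_relators ?K' = crossing_relators K"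
    by (intro ext) (simp add: crossing_relators_eq code)
  then have "relators ?K' = relators K" by (simp add: relators_def code)
  then have "alexander_matrix ?K' = alexander_matrix K"
    by (simp add: alexander_matrix_def generators_def code)
  then show ?thesis by (simp add: PhiDelta_def code)
qed

theorem corollary7:
  fixes K K' :: diagram and S :: "nat set"
  assumes "knot_diagram K"
    and "\<not> is_classical K"
    and "PhiDelta K \<noteq> 0"
    and "S \<subseteq> odd_crossings K"
    and "K' = switch_crossings S K"
  shows "\<not> equivalent K' unknot"
proof
  assume "equivalent K' unknot"
  then have "laurent.colourable K'"
    using laurent.colourable_equivalent laurent.colourable_unknot by blast
  moreover have "well_formed (code K')"
    using assms(1,5) by (simp add: knot_diagram_def switch_crossings_def)
  ultimately have "PhiDelta K' = 0" by (intro PhiDelta_colourable)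
  then show False using assms(3,5) PhiDelta_switch_odd [OF assms(4)] by simp
qed

end
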